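(* Let $F:\mathbb{R}^n\rightrightarrows\mathbb{R}^n$ satisfy assumption (F), let $\mathcal{K}\subset\mathbb{R}^n$ be closed, let $\mathcal{T}$ be the associated minimum time function, and let $x\in\mathcal{R}\setminus\mathcal{K}$. (i) If $\zeta\in N^P_{\mathcal{R}(\mathcal{T}(x))}(x)$, then $(\zeta,h(x,\zeta))\in N^P_{\mathrm{epi}(\mathcal{T})}(x,\mathcal{T}(x))$. (ii) If $\zeta\in\mathbb{R}^n$ and $\alpha\in\mathbb{R}$ satisfy $(\zeta,\alpha)\in N^P_{\mathrm{epi}(\mathcal{T})}(x,\mathcal{T}(x))$, then $\alpha\le0$, $\zeta\in N^P_{\mathcal{R}(\mathcal{T}(x))}(x)$ and $h(x,\zeta)=\alpha$.
   Context: Assumption (F) on a multifunction $F:\mathbb{R}^n\rightrightarrows\mathbb{R}^n$: (F1) $F(x)$ is nonempty, convex and compact for each $x\in\mathbb{R}^n$; (F2) for each compact $Q\subset\mathbb{R}^n$ there is $L>0$ with $F(x)\subset F(y)+L|y-x|\bar{\mathbb{B}}$ for all $x,y\in Q$, where $\bar{\mathbb{B}}$ is the closed unit ball; (F3) there is $\gamma>0$ with $\max\{|v|:v\in F(x)\}\le\gamma(1+|x|)$ for all $x\in\mathbb{R}^n$. A trajectory of $F$ starting at $x$ is an absolutely continuous $x(\cdot)$ on $[0,T]$ with $\dot x(t)\in F(x(t))$ for a.e. $t$ and $x(0)=x$. The minimum time function $\mathcal{T}:\mathbb{R}^n\to[0,+\infty]$ associated with the closed target $\mathcal{K}$ is $\mathcal{T}(x)=0$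 if $x\in\mathcal{K}$, and otherwise $\mathcal{T}(x)=\inf\{T>0:\text{there is a trajectory } x(\cdot) \text{ of } F \text{ with } x(0)=x,\ x(T)\in\mathcal{K}\}$, with $\inf\emptyset=+\infty$. The controllable set is $\mathcal{R}=\{x:\mathcal{T}(x)<+\infty\}$, and for $t\ge0$, $\mathcal{R}(t)=\{x:\mathcal{T}(x)\le t\}$ (so $\mathcal{R}(0)=\mathcal{K}$). Minimized Hamiltonian: $h(x,\zeta)=\min_{v\in F(x)}\langle v,\zeta\rangle$. For a closed set $E$ and $x\in E$, the proximal normal cone $N^P_E(x)$ is the set of $v$ for which there is $\sigma\ge0$ with $\langle v,y-x\rangle\le\sigma|y-x|^2$ for all $y\in E$. The epigraph is $\mathrm{epi}(\mathcal{T})=\{(x,\beta)\in\mathbb{R}^n\times\mathbb{R}:\mathcal{T}(x)<+\infty,\ \beta\ge\mathcal{T}(x)\}$. *)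

theory Defs
  imports "HOL-Analysis.Analysis"
begin

text \<open>Multifunctions from a Euclidean space to itself are set-valued functions \<open>F :: 'a \<Rightarrow> 'a set\<close>.\<close>

text \<open>Under F1 every maximum in F3 exists, and it is at most \<open>c\<close> iff all norms are at most \<open>c\<close>.\<close>

definition assumption_F :: "('a::euclidean_space \<Rightarrow> 'a set) \<Rightarrow> bool" where
  "assumption_F F \<longleftrightarrow>
     (\<forall>x. F x \<noteq> {} \<and> convex (F x) \<and> compact (F x)) \<and>
     (\<forall>Q. compact Q \<longrightarrow>
        (\<exists>L>0. \<forall>x\<in>Q. \<forall>y\<in>Q.
           F x \<subseteq> {w + (L * norm (y - x)) *\<^sub>R u | w u. w \<in> F y \<and> u \<in> cball 0 1})) \<and>
     (\<exists>\<gamma>>0. \<forall>x. \<forall>v\<in>F x. norm v \<le> \<gamma> * (1 + norm x))"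

text \<open>The usual epsilon-delta definition. A \<open>D\<close> with \<open>D division_of \<Union>D\<close> is a finite
  family of nonempty compact intervals with pairwise disjoint interiors; \<open>Inf k\<close> and \<open>Sup k\<close>
  are the endpoints of \<open>k\<close>. The library constant \<open>absolutely_continuous\<close> is about measures
  and unrelated.\<close>

definition abs_continuous_on_interval :: "real \<Rightarrow> real \<Rightarrow> (real \<Rightarrow> 'a::real_normed_vector) \<Rightarrow> bool" where
  "abs_continuous_on_interval a b f \<longleftrightarrow>
     (\<forall>\<epsilon>>0. \<exists>\<delta>>0. \<forall>D. D division_of \<Union>D \<and> \<Union>D \<subseteq> {a..b} \<and> (\<Sum>k\<in>D. Sup k - Inf k) < \<delta> \<longrightarrow>
        (\<Sum>k\<in>D. norm (f (Sup k) - f (Inf k))) < \<epsilon>)"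

text \<open>Only the values of \<open>f\<close> on \<open>{0..T}\<close> matter; at interior points the derivative within
  \<open>{0..T}\<close> is the ordinary one.\<close>

definition trajectory ::
  "('a::euclidean_space \<Rightarrow> 'a set) \<Rightarrow> 'a \<Rightarrow> real \<Rightarrow> (real \<Rightarrow> 'a) \<Rightarrow> bool" where
  "trajectory F x T f \<longleftrightarrow>
     abs_continuous_on_interval 0 T f \<and>
     (AE t in lebesgue. t \<in> {0..T} \<longrightarrow>
        (\<exists>v\<in>F (f t). (f has_vector_derivative v) (at t within {0..T}))) \<and>
     f 0 = x"

definition min_time :: "('a::euclidean_space \<Rightarrow> 'a set) \<Rightarrow> 'a set \<Rightarrow> 'a \<Rightarrow> ereal" where
  "min_time F K x =
     (if x \<in> K then 0 else Inf {ereal T | T. T > 0 \<and> (\<exists>f. trajectory F x T f \<and> f T \<in> K)})"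

definition controllable_set :: "('a::euclidean_space \<Rightarrow> 'a set) \<Rightarrow> 'a set \<Rightarrow> 'a set" where
  "controllable_set F K = {x. min_time F K x < \<infinity>}"

definition reachable_within :: "('a::euclidean_space \<Rightarrow> 'a set) \<Rightarrow> 'a set \<Rightarrow> real \<Rightarrow> 'a set" where
  "reachable_within F K t = {x. min_time F K x \<le> ereal t}"

text \<open>The infimum is attained whenever \<open>F x\<close> is nonempty and compact, see the next lemma.\<close>

definition min_hamiltonian :: "('a::euclidean_space \<Rightarrow> 'a set) \<Rightarrow> 'a \<Rightarrow> 'a \<Rightarrow> real" where
  "min_hamiltonian F x \<zeta> = (INF v\<in>F x. v \<bullet> \<zeta>)"

lemma min_hamiltonian_attained:
  assumes "F x \<noteq> {}" "compact (F x)"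
  shows "\<exists>v\<in>F x. min_hamiltonian F x \<zeta> = v \<bullet> \<zeta> \<and> (\<forall>w\<in>F x. v \<bullet> \<zeta> \<le> w \<bullet> \<zeta>)"
proof -
  have "continuous_on (F x) (\<lambda>v. v \<bullet> \<zeta>)"
    by (intro continuous_intros)
  from continuous_attains_inf[OF assms(2,1) this]
  obtain v where v: "v \<in> F x" "\<forall>w\<in>F x. v \<bullet> \<zeta> \<le> w \<bullet> \<zeta>" by blast
  then have "min_hamiltonian F x \<zeta> = v \<bullet> \<zeta>"
    unfolding min_hamiltonian_def by (intro cInf_eq_minimum) auto
  with v show ?thesis by blast
qed

definition proximal_normal_cone :: "'a::real_inner set \<Rightarrow> 'a \<Rightarrow> 'a set" where
  "proximal_normal_cone E x =
     {v. \<exists>\<sigma>\<ge>0. \<forall>y\<in>E. v \<bullet> (y - x) \<le> \<sigma> * (norm (y - x))\<^sup>2}"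

definition epi :: "('a \<Rightarrow> ereal) \<Rightarrow> ('a \<times> real) set" where
  "epi f = {(x, \<beta>). f x < \<infinity> \<and> f x \<le> ereal \<beta>}"

end

theory Submission
  imports Defs
begin

text \<open>Write \<open>\<tau>\<close> for the minimum time from \<open>x\<close> and \<open>h\<close> for the minimized Hamiltonian at
  \<open>(x, \<zeta>)\<close>. Near \<open>x\<close>, a trajectory started at \<open>y\<close> satisfies
  \<open>\<zeta> \<bullet> (f s - y) \<ge> s h - O(s (\<bar>y - x\<bar> + s))\<close>, and every \<open>y\<close> is reached in time \<open>s\<close> from some
  \<open>z\<close> with \<open>\<zeta> \<bullet> (z - y) \<ge> - s h - O(s (\<bar>y - x\<bar> + s))\<close>. A point \<open>(y, \<beta>)\<close> of the epigraph is
  thus moved to the sublevel set \<open>\<tau>\<close> of the minimum time function: backward for time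
  \<open>\<tau> - \<beta>\<close> if \<open>\<beta> \<le> \<tau>\<close>, and forward along a nearly optimal trajectory if the minimum time from
  \<open>y\<close> exceeds \<open>\<tau>\<close>; the errors are of second order. Conversely, moving \<open>x\<close> itself forward and
  backward forces the last component of an epigraph normal to equal \<open>h\<close>.\<close>

section \<open>Increments of absolutely continuous functions\<close>

lemma inner_le_norm_mult:
  fixes u v :: "'a::real_inner"
  assumes "norm v \<le> r"
  shows "u \<bullet> v \<le> norm u * r"
  using norm_cauchy_schwarz mult_left_mono[OF assms norm_ge_zero] by (rule order_trans)

lemma negligible_outer_open:
  fixes N :: "'a::euclidean_space set"
  assumes "negligible N" "\<epsilon> > 0"
  obtains U where "open U" "N \<subseteq> U" "U \<in> lmeasurable" "measure lebesgue U < \<epsilon>"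
proof -
  have N: "N \<in> null_sets lebesgue"
    using assms(1) by (simp add: negligible_iff_null_sets)
  then obtain U where U: "open U" "N \<subseteq> U" "U - N \<in> lmeasurable"
      "emeasure lebesgue (U - N) < ennreal \<epsilon>"
    using sets_lebesgue_outer_open[of N \<epsilon>] assms(2) by blast
  have "emeasure lebesgue U = emeasure lebesgue (U - N)"
    using emeasure_Diff_null_set[OF N, of U] U(1) by (simp add: borel_open)
  moreover from this U have "emeasure lebesgue U < \<infinity>"
    by (metis ennreal_less_top infinity_ennreal_def order_less_trans)
  moreover have "U \<in> sets lebesgue"
    using U(1) by (simp add: borel_open)
  ultimately have "U \<in> lmeasurable" "measure lebesgue U < \<epsilon>"
    using U(4) assms(2)
    by (auto simp: fmeasurable_def measure_def enn2real_less_iff)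
  with U that show ?thesis by blast
qed

lemma division_sum_length_le_measure:
  fixes D :: "real set set"
  assumes "D division_of \<Union>D" "\<Union>D \<subseteq> U" "U \<in> lmeasurable"
  shows "(\<Sum>k\<in>D. Sup k - Inf k) \<le> measure lebesgue U"
proof -
  have "(\<Sum>k\<in>D. Sup k - Inf k) = (\<Sum>k\<in>D. measure lebesgue k)"
  proof (rule sum.cong)
    fix k assume "k \<in> D"
    then obtain a b where "k = cbox a b" "k \<noteq> {}"
      using assms(1) by (metis division_ofD(3,4))
    then show "Sup k - Inf k = measure lebesgue k"
      by auto
  qed simp
  also have "\<dots> = measure lebesgue (\<Union>D)"
    using content_division[OF assms(1)] by simp
  also have "\<dots> \<le> measure lebesgue U"
    using assms by (intro measure_mono_fmeasurable) (auto intro: lmeasurable_division fmeasurableD)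
  finally show ?thesis .
qed

text \<open>The proof splits a gauge-fine tagged division by its tags. Intervals tagged outside
  \<open>N\<close> obey the derivative bound up to \<epsilon> times their length; intervals tagged
  in \<open>N\<close> lie in an open set of small measure, so absolute continuity makes their total
  variation small.\<close>

lemma abs_continuous_inner_increment_le:
  fixes f :: "real \<Rightarrow> 'a::euclidean_space"
  assumes "a \<le> b" and ac: "abs_continuous_on_interval a b f" and N: "negligible N"
    and der: "\<And>t. t \<in> {a..b} - N \<Longrightarrow>
      \<exists>v. (f has_vector_derivative v) (at t within {a..b}) \<and> \<zeta> \<bullet> v \<le> c"
  shows "\<zeta> \<bullet> (f b - f a) \<le> c * (b - a)"
proof -
  obtain v where v: "\<And>t. t \<in> {a..b} - N \<Longrightarrow> (f has_vector_derivative v t) (at t within {a..b})"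
      "\<And>t. t \<in> {a..b} - N \<Longrightarrow> \<zeta> \<bullet> v t \<le> c"
    using der by metis
  \<comment> \<open>The three error sources are the differentiability error on the good intervals
    (\<open>(b - a) * norm \<zeta>\<close>), the length lost to the bad intervals
    (\<open>\<bar>c\<bar>\<close>) and the variation over them (\<open>norm \<zeta>\<close>). The
    added ones keep \<open>B\<close> positive.\<close>
  define B where "B = (b - a) * (norm \<zeta> + 1) + \<bar>c\<bar> + norm \<zeta> + 1"
  have main: "\<zeta> \<bullet> (f b - f a) \<le> c * (b - a) + \<epsilon> * B" if \<epsilon>: "\<epsilon> > 0" for \<epsilon>
  proof -
    obtain \<delta> where \<delta>: "\<delta> > 0" "\<And>D. D division_of \<Union>D \<Longrightarrow> \<Union>D \<subseteq> {a..b} \<Longrightarrow>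
        (\<Sum>k\<in>D. Sup k - Inf k) < \<delta> \<Longrightarrow> (\<Sum>k\<in>D. norm (f (Sup k) - f (Inf k))) < \<epsilon>"
      using ac[unfolded abs_continuous_on_interval_def, rule_format, OF \<epsilon>] by blast
    obtain U where U: "open U" "N \<subseteq> U" "U \<in> lmeasurable" "measure lebesgue U < min \<delta> \<epsilon>"
      using negligible_outer_open[OF N, of "min \<delta> \<epsilon>"] \<delta>(1) \<epsilon> by auto
    have "\<exists>d>0. \<forall>y\<in>{a..b}. \<bar>y - t\<bar> < d \<longrightarrow>
        norm (f y - f t - (y - t) *\<^sub>R v t) \<le> \<epsilon> * \<bar>y - t\<bar>" if "t \<in> {a..b} - N" for t
    proof -
      have "\<forall>e>0. \<exists>d>0. \<forall>y\<in>{a..b}. norm (y - t) < d \<longrightarrow>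
          norm (f y - f t - (y - t) *\<^sub>R v t) \<le> e * norm (y - t)"
        using v(1)[OF that] unfolding has_vector_derivative_def has_derivative_within_alt by blast
      with \<epsilon> show ?thesis by (simp only: real_norm_def)
    qed
    then obtain d where d: "\<And>t. t \<in> {a..b} - N \<Longrightarrow> d t > 0"
      "\<And>t y. t \<in> {a..b} - N \<Longrightarrow> y \<in> {a..b} \<Longrightarrow> \<bar>y - t\<bar> < d t \<Longrightarrow>
        norm (f y - f t - (y - t) *\<^sub>R v t) \<le> \<epsilon> * \<bar>y - t\<bar>"
      by metis
    \<comment> \<open>A tag in \<open>N\<close> forces its interval into the small set
      \<open>U\<close>; any other tag in \<open>{a..b}\<close> forces it into the ball where the
      first-order expansion at the tag is valid.\<close>
    define g where "g t = (if t \<in> N then U else if t \<in> {a..b} then ball t (d t) else UNIV)" for t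
    have "gauge g"
      using U d(1) unfolding g_def gauge_def by auto
    then obtain p where p: "p tagged_division_of {a..b}" "g fine p"
      using fine_division_exists_real by blast
    define q where "q = {(t, k) \<in> p. t \<in> N}"
    have qp: "q \<subseteq> p" by (auto simp: q_def)
    have finp: "finite p" using p(1) by (rule tagged_division_of_finite)
    have memb: "\<exists>u w. k = {u..w} \<and> u \<le> w \<and> a \<le> u \<and> w \<le> b \<and> t \<in> {u..w} \<and> {u..w} \<subseteq> g t"
      if tk: "(t, k) \<in> p" for t k
    proof -
      obtain u w where k: "k = cbox u w"
        using tagged_division_ofD(4)[OF p(1) tk] by blast
      have "t \<in> k" "k \<subseteq> {a..b}" "k \<subseteq> g t"
        using tagged_division_ofD(2,3)[OF p(1) tk] p(2) tk by (auto simp: fine_def)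
      then show ?thesis unfolding k by (auto intro!: exI[of _ u] exI[of _ w])
    qed
    have q_part: "q tagged_partial_division_of {a..b}"
      using p(1) qp tagged_partial_division_subset unfolding tagged_division_of_def by blast
    have q_div: "snd ` q division_of \<Union>(snd ` q)"
      by (rule partial_division_of_tagged_division[OF q_part])
    \<comment> \<open>Absolute continuity speaks of sets of intervals, whereas \<open>q\<close>
      consists of tagged pairs. Two pairs can share an interval only if it is degenerate, and there
      \<open>h\<close> vanishes. The \<open>if\<close> gives the empty interval the value 0, since
      its \<open>Sup\<close> and \<open>Inf\<close> are unspecified.\<close>
    have over: "(\<Sum>(t, k)\<in>q. h (Sup k) (Inf k)) = (\<Sum>k\<in>snd ` q. h (Sup k) (Inf k))"
      if "\<And>u. h u u = 0" for h :: "real \<Rightarrow> real \<Rightarrow> real"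
    proof -
      have "(\<Sum>(t, k)\<in>q. h (Sup k) (Inf k)) =
          (\<Sum>(t, k)\<in>q. if k = {} then 0 else h (Sup k) (Inf k))"
        using memb qp by (intro sum.cong) fastforce+
      also have "\<dots> = (\<Sum>k\<in>snd ` q. if k = {} then 0 else h (Sup k) (Inf k))"
        using that
        by (intro sum.over_tagged_division_lemma[OF tagged_partial_division_of_Union_self[OF q_part]])
           (auto simp: box_eq_empty)
      also have "\<dots> = (\<Sum>k\<in>snd ` q. h (Sup k) (Inf k))"
        using memb qp by (intro sum.cong) fastforce+
      finally show ?thesis .
    qed
    have "\<Union>(snd ` q) \<subseteq> U"
      using memb qp by (fastforce simp: q_def g_def)
    then have lenU: "(\<Sum>k\<in>snd ` q. Sup k - Inf k) < min \<delta> \<epsilon>"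
      using division_sum_length_le_measure[OF q_div _ U(3)] U(4) by simp
    have q_sub: "\<Union>(snd ` q) \<subseteq> {a..b}"
      using memb qp by fastforce
    have q_var: "(\<Sum>(t, k)\<in>q. norm (f (Sup k) - f (Inf k))) < \<epsilon>"
      using \<delta>(2)[OF q_div q_sub] lenU over[of "\<lambda>x y. norm (f x - f y)"] by simp
    have q_len: "(\<Sum>(t, k)\<in>q. Sup k - Inf k) < \<epsilon>"
      using lenU over[of "\<lambda>x y. x - y"] by simp
    have q_len0: "(\<Sum>(t, k)\<in>q. Sup k - Inf k) \<ge> 0"
      using memb qp by (intro sum_nonneg) fastforce
    have p_len: "(\<Sum>(t, k)\<in>p. Sup k - Inf k) = b - a"
      using additive_tagged_division_1[OF assms(1) p(1), of "\<lambda>x. x"] by simp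
    have p_len_q: "(\<Sum>(t, k)\<in>p. Sup k - Inf k) = (\<Sum>(t, k)\<in>p - q. Sup k - Inf k) + (\<Sum>(t, k)\<in>q. Sup k - Inf k)"
      using sum.subset_diff[OF qp finp] by blast
    have good: "\<zeta> \<bullet> (f (Sup k) - f (Inf k)) \<le> (c + \<epsilon> * norm \<zeta>) * (Sup k - Inf k)"
      if tk: "(t, k) \<in> p - q" for t k
    proof -
      obtain u w where k: "k = {u..w}" "u \<le> w" "a \<le> u" "w \<le> b" "t \<in> {u..w}" "{u..w} \<subseteq> g t"
        using memb tk by blast
      have t: "t \<in> {a..b} - N" using tk k by (auto simp: q_def)
      have "{u..w} \<subseteq> ball t (d t)" using k(6) t by (simp add: g_def)
      moreover have "u \<in> {u..w}" "w \<in> {u..w}" using k(2) by auto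
      ultimately have "u \<in> ball t (d t)" "w \<in> ball t (d t)" by blast+
      then have uw: "\<bar>u - t\<bar> < d t" "\<bar>w - t\<bar> < d t" by (auto simp: dist_real_def)
      \<comment> \<open>Both endpoints are compared with the tag. As the tag lies between them, the
        two errors add up to \<epsilon> times the length of the interval.\<close>
      have 1: "norm (f w - f t - (w - t) *\<^sub>R v t) \<le> \<epsilon> * (w - t)"
        using d(2)[OF t _ uw(2)] k by auto
      have 2: "norm (f u - f t - (u - t) *\<^sub>R v t) \<le> \<epsilon> * (t - u)"
        using d(2)[OF t _ uw(1)] k by auto
      have "norm (f w - f u - (w - u) *\<^sub>R v t) \<le> \<epsilon> * (w - u)"
        using norm_triangle_ineq4[of "f w - f t - (w - t) *\<^sub>R v t" "f u - f t - (u - t) *\<^sub>R v t"] 1 2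
        by (simp add: algebra_simps)
      then have "\<zeta> \<bullet> (f w - f u - (w - u) *\<^sub>R v t) \<le> norm \<zeta> * (\<epsilon> * (w - u))"
        by (rule inner_le_norm_mult)
      moreover have "(w - u) * (\<zeta> \<bullet> v t) \<le> (w - u) * c"
        using v(2)[OF t] k(2) by (intro mult_left_mono) auto
      ultimately show ?thesis
        using k by (simp add: inner_diff_right algebra_simps)
    qed
    have "\<zeta> \<bullet> (f b - f a) = (\<Sum>(t, k)\<in>p. \<zeta> \<bullet> (f (Sup k) - f (Inf k)))"
      using additive_tagged_division_1[OF assms(1) p(1), of "\<lambda>t. \<zeta> \<bullet> f t"]
      by (simp add: inner_diff_right)
    also have "\<dots> = (\<Sum>(t, k)\<in>p - q. \<zeta> \<bullet> (f (Sup k) - f (Inf k))) + (\<Sum>(t, k)\<in>q. \<zeta> \<bullet> (f (Sup k) - f (Inf k)))"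
      using sum.subset_diff[OF qp finp] by blast
    also have "\<dots> \<le> (\<Sum>(t, k)\<in>p - q. (c + \<epsilon> * norm \<zeta>) * (Sup k - Inf k)) + (\<Sum>(t, k)\<in>q. norm \<zeta> * norm (f (Sup k) - f (Inf k)))"
      by (intro add_mono sum_mono) (auto intro: good norm_cauchy_schwarz)
    also have "\<dots> = (c + \<epsilon> * norm \<zeta>) * (\<Sum>(t, k)\<in>p - q. Sup k - Inf k) + norm \<zeta> * (\<Sum>(t, k)\<in>q. norm (f (Sup k) - f (Inf k)))"
      by (simp add: sum_distrib_left case_prod_unfold)
    also have "\<dots> \<le> (c + \<epsilon> * norm \<zeta>) * (b - a) + \<bar>c\<bar> * \<epsilon> + norm \<zeta> * \<epsilon>"
    proof -
      \<comment> \<open>The good intervals have total length \<open>b - a - s\<close>; when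
        \<open>c\<close> is negative the missing length costs \<open>- c * s\<close>, at most
        \<open>\<bar>c\<bar> * \<epsilon>\<close>.\<close>
      define s where "s = (\<Sum>(t, k)\<in>q. Sup k - Inf k)"
      have s: "0 \<le> s" "s \<le> \<epsilon>" using q_len q_len0 by (auto simp: s_def)
      have len: "(\<Sum>(t, k)\<in>p - q. Sup k - Inf k) = b - a - s"
        using p_len p_len_q by (simp add: s_def)
      moreover have "- c * s \<le> \<bar>c\<bar> * \<epsilon>"
        using s by (intro mult_mono) auto
      moreover have "norm \<zeta> * (\<Sum>(t, k)\<in>q. norm (f (Sup k) - f (Inf k))) \<le> norm \<zeta> * \<epsilon>"
        using q_var by (intro mult_left_mono) auto
      moreover have "0 \<le> \<epsilon> * norm \<zeta> * s" using s \<epsilon> by simp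
      ultimately show ?thesis unfolding len by (simp add: algebra_simps)
    qed
    also have "\<dots> \<le> c * (b - a) + \<epsilon> * B"
      using \<epsilon> \<open>a \<le> b\<close>
      by (simp add: B_def distrib_left distrib_right mult.commute mult.left_commute add_nonneg_nonneg)
    finally show ?thesis .
  qed
  have B: "B > 0" using \<open>a \<le> b\<close> by (auto simp: B_def intro!: add_nonneg_pos)
  show ?thesis
  proof (rule field_le_epsilon)
    fix e :: real assume "e > 0"
    then show "\<zeta> \<bullet> (f b - f a) \<le> c * (b - a) + e"
      using main[of "e / B"] B by simp
  qed
qed

section \<open>Absolute continuity: restriction, continuity and Lipschitz functions\<close>

lemma abs_continuous_on_subinterval:
  assumes "abs_continuous_on_interval a b f" "a \<le> c" "d \<le> b"
  shows "abs_continuous_on_interval c d f"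
  unfolding abs_continuous_on_interval_def
proof (intro allI impI)
  fix \<epsilon> :: real assume "\<epsilon> > 0"
  have sub: "{c..d} \<subseteq> {a..b}" using assms by auto
  obtain \<delta> where "\<delta> > 0" "\<And>D. D division_of \<Union>D \<Longrightarrow> \<Union>D \<subseteq> {a..b} \<Longrightarrow>
      (\<Sum>k\<in>D. Sup k - Inf k) < \<delta> \<Longrightarrow> (\<Sum>k\<in>D. norm (f (Sup k) - f (Inf k))) < \<epsilon>"
    using assms(1)[unfolded abs_continuous_on_interval_def, rule_format, OF \<open>\<epsilon> > 0\<close>] by blast
  with sub show "\<exists>\<delta>>0. \<forall>D. D division_of \<Union>D \<and> \<Union>D \<subseteq> {c..d} \<and> (\<Sum>k\<in>D. Sup k - Inf k) < \<delta> \<longrightarrow>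
      (\<Sum>k\<in>D. norm (f (Sup k) - f (Inf k))) < \<epsilon>"
    by (meson subset_trans)
qed

lemma abs_continuous_imp_continuous_on:
  assumes "abs_continuous_on_interval a b f"
  shows "continuous_on {a..b} f"
  unfolding continuous_on_iff
proof (intro ballI allI impI)
  fix s \<epsilon> :: real assume s: "s \<in> {a..b}" and "\<epsilon> > 0"
  obtain \<delta> where \<delta>: "\<delta> > 0" "\<And>D. D division_of \<Union>D \<Longrightarrow> \<Union>D \<subseteq> {a..b} \<Longrightarrow>
      (\<Sum>k\<in>D. Sup k - Inf k) < \<delta> \<Longrightarrow> (\<Sum>k\<in>D. norm (f (Sup k) - f (Inf k))) < \<epsilon>"
    using assms[unfolded abs_continuous_on_interval_def, rule_format, OF \<open>\<epsilon> > 0\<close>] by blast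
  have le: "dist (f v) (f u) < \<epsilon>" if "u \<in> {a..b}" "v \<in> {a..b}" "u \<le> v" "v - u < \<delta>" for u v
  proof -
    have "{{u..v}} division_of \<Union>{{u..v}}"
      using division_of_self[of u v] that by (simp add: cbox_interval)
    then show ?thesis
      using \<delta>(2)[of "{{u..v}}"] that by (simp add: dist_norm)
  qed
  show "\<exists>d>0. \<forall>t\<in>{a..b}. dist t s < d \<longrightarrow> dist (f t) (f s) < \<epsilon>"
  proof (intro exI conjI ballI impI)
    fix t assume "t \<in> {a..b}" "dist t s < \<delta>"
    then show "dist (f t) (f s) < \<epsilon>"
      using le[of s t] le[of t s] s
      by (cases "s \<le> t") (auto simp: dist_real_def dist_commute)
  qed (rule \<delta>)
qed

lemma lipschitz_on_imp_abs_continuous: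
  fixes f :: "real \<Rightarrow> 'a::real_normed_vector"
  assumes "M-lipschitz_on {a..b} f"
  shows "abs_continuous_on_interval a b f"
  unfolding abs_continuous_on_interval_def
proof (intro allI impI)
  fix \<epsilon> :: real assume "\<epsilon> > 0"
  have M: "M \<ge> 0" using assms by (rule lipschitz_on_nonneg)
  show "\<exists>\<delta>>0. \<forall>D. D division_of \<Union>D \<and> \<Union>D \<subseteq> {a..b} \<and> (\<Sum>k\<in>D. Sup k - Inf k) < \<delta> \<longrightarrow>
      (\<Sum>k\<in>D. norm (f (Sup k) - f (Inf k))) < \<epsilon>"
  proof (intro exI conjI allI impI; (elim conjE)?)
    show "0 < \<epsilon> / (M + 1)" using \<open>\<epsilon> > 0\<close> M by simp
    fix D assume D: "D division_of \<Union>D" "\<Union>D \<subseteq> {a..b}" "(\<Sum>k\<in>D. Sup k - Inf k) < \<epsilon> / (M + 1)"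
    have memb: "Inf k \<le> Sup k \<and> Inf k \<in> {a..b} \<and> Sup k \<in> {a..b}" if k: "k \<in> D" for k
    proof -
      obtain u v where uv: "k = cbox u v" "k \<noteq> {}"
        using D(1) k by (metis division_ofD(3,4))
      moreover have "k \<subseteq> {a..b}" using D(2) k by blast
      ultimately show ?thesis by auto
    qed
    have "(\<Sum>k\<in>D. norm (f (Sup k) - f (Inf k))) \<le> (\<Sum>k\<in>D. M * (Sup k - Inf k))"
    proof (rule sum_mono)
      fix k assume "k \<in> D"
      then show "norm (f (Sup k) - f (Inf k)) \<le> M * (Sup k - Inf k)"
        using lipschitz_onD[OF assms, of "Sup k" "Inf k"] memb[of k]
        by (simp add: dist_norm)
    qed
    also have "\<dots> = M * (\<Sum>k\<in>D. Sup k - Inf k)"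
      by (simp add: sum_distrib_left)
    also have "\<dots> \<le> (M + 1) * (\<Sum>k\<in>D. Sup k - Inf k)"
      using memb by (intro mult_right_mono sum_nonneg) auto
    also have "\<dots> < \<epsilon>"
      using D(3) M by (simp add: field_simps)
    finally show "(\<Sum>k\<in>D. norm (f (Sup k) - f (Inf k))) < \<epsilon>" .
  qed
qed

section \<open>Trajectories\<close>

lemma trajectory_derivative:
  assumes "trajectory F x T f"
  obtains N where "negligible N"
    "\<And>t. t \<in> {0..T} - N \<Longrightarrow> \<exists>v\<in>F (f t). (f has_vector_derivative v) (at t within {0..T})"
proof -
  from assms obtain N where "N \<in> null_sets lebesgue"
    "{t \<in> space lebesgue. \<not> (t \<in> {0..T} \<longrightarrow>
      (\<exists>v\<in>F (f t). (f has_vector_derivative v) (at t within {0..T})))} \<subseteq> N"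
    unfolding trajectory_def eventually_ae_filter by blast
  with that[of N] show ?thesis
    by (auto simp: negligible_iff_null_sets)
qed

lemma trajectoryI:
  assumes "M-lipschitz_on {0..T} f" "f 0 = x" "negligible N"
    and der: "\<And>t. t \<in> {0..T} - N \<Longrightarrow>
      \<exists>v\<in>F (f t). (f has_vector_derivative v) (at t within {0..T})"
  shows "trajectory F x T f"
proof -
  have "AE t in lebesgue. t \<in> {0..T} \<longrightarrow>
      (\<exists>v\<in>F (f t). (f has_vector_derivative v) (at t within {0..T}))"
    by (rule AE_I'[of N]) (use assms(3) der in \<open>auto simp: negligible_iff_null_sets\<close>)
  with assms(1,2) show ?thesis
    unfolding trajectory_def by (blast intro: lipschitz_on_imp_abs_continuous)
qed

lemma trajectory_inner_increment_le:
  assumes f: "trajectory F x T f" and ab: "0 \<le> a" "a \<le> b" "b \<le> T"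
    and bnd: "\<And>t v. t \<in> {a..b} \<Longrightarrow> v \<in> F (f t) \<Longrightarrow> \<zeta> \<bullet> v \<le> c"
  shows "\<zeta> \<bullet> (f b - f a) \<le> c * (b - a)"
proof -
  obtain N where N: "negligible N"
    "\<And>t. t \<in> {0..T} - N \<Longrightarrow> \<exists>v\<in>F (f t). (f has_vector_derivative v) (at t within {0..T})"
    using trajectory_derivative[OF f] by blast
  have sub: "{a..b} \<subseteq> {0..T}" using ab by auto
  have "abs_continuous_on_interval a b f"
    using f ab unfolding trajectory_def by (blast intro: abs_continuous_on_subinterval)
  moreover have "\<exists>v. (f has_vector_derivative v) (at t within {a..b}) \<and> \<zeta> \<bullet> v \<le> c"
    if "t \<in> {a..b} - N" for t
    using N(2)[of t] bnd that sub has_vector_derivative_within_subset by (metis DiffD1 DiffD2 DiffI subsetD)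
  ultimately show ?thesis
    using abs_continuous_inner_increment_le ab(2) N(1) by blast
qed

text \<open>The directional estimate is applied in the direction \<open>f b - f a\<close> of the
  increment itself, after which one factor of its norm is cancelled.\<close>

lemma trajectory_norm_increment_le:
  assumes f: "trajectory F x T f" and ab: "0 \<le> a" "a \<le> b" "b \<le> T" and "0 \<le> M"
    and bnd: "\<And>t v. t \<in> {a..b} \<Longrightarrow> v \<in> F (f t) \<Longrightarrow> norm v \<le> M"
  shows "norm (f b - f a) \<le> M * (b - a)"
proof (cases "f b = f a")
  case True
  with assms show ?thesis by simp
next
  case False
  let ?z = "f b - f a"
  have "?z \<bullet> ?z \<le> (norm ?z * M) * (b - a)"
    by (intro trajectory_inner_increment_le[OF f ab] inner_le_norm_mult bnd)
  then have "norm ?z * norm ?z \<le> norm ?z * (M * (b - a))"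
    by (simp add: dot_square_norm power2_eq_square mult.assoc)
  then show ?thesis using False by simp
qed

section \<open>Consequences of assumption (F) and a priori estimates\<close>

lemma assumption_F_values:
  assumes "assumption_F F"
  shows "F x \<noteq> {}" "convex (F x)" "compact (F x)"
  using assms by (simp_all add: assumption_F_def)

lemma assumption_F_growth:
  assumes "assumption_F F"
  obtains \<gamma> where "\<gamma> > 0" "\<And>x v. v \<in> F x \<Longrightarrow> norm v \<le> \<gamma> * (1 + norm x)"
proof -
  have "\<exists>\<gamma>>0. \<forall>x. \<forall>v\<in>F x. norm v \<le> \<gamma> * (1 + norm x)"
    using assms by (simp add: assumption_F_def)
  with that show ?thesis by blast
qed

lemma assumption_F_lipschitz:
  assumes "assumption_F F" "compact Q"
  obtains L where "L > 0"
    "\<And>y z v. y \<in> Q \<Longrightarrow> z \<in> Q \<Longrightarrow> v \<in> F y \<Longrightarrow> \<exists>w\<in>F z. norm (v - w) \<le> L * norm (y - z)"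
proof -
  obtain L where L: "L > 0" "\<And>y z. y \<in> Q \<Longrightarrow> z \<in> Q \<Longrightarrow>
      F y \<subseteq> {w + (L * norm (z - y)) *\<^sub>R u | w u. w \<in> F z \<and> u \<in> cball 0 1}"
    using assms unfolding assumption_F_def by meson
  have "\<exists>w\<in>F z. norm (v - w) \<le> L * norm (y - z)" if vyz: "y \<in> Q" "z \<in> Q" "v \<in> F y" for y z v
  proof -
    obtain w u where "w \<in> F z" "norm u \<le> 1" "v = w + (L * norm (z - y)) *\<^sub>R u"
      using L(2)[OF vyz(1,2)] vyz(3) by (auto simp: dist_norm)
    moreover from this have "norm (v - w) \<le> L * norm (y - z)"
      using L(1) by (simp add: norm_minus_commute mult_left_le)
    ultimately show ?thesis by blast
  qed
  with L(1) that show ?thesis by blast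
qed

text \<open>The range on a compact interval is bounded, so linear growth bounds all velocities
  there. The Lipschitz property is what is carried through time shifts and concatenations, where
  \<open>trajectoryI\<close> turns it back into absolute continuity.\<close>

lemma trajectory_imp_lipschitz_on:
  assumes F: "assumption_F F" and f: "trajectory F x T f"
  obtains M where "M-lipschitz_on {0..T} f"
proof -
  obtain \<gamma> where \<gamma>: "\<gamma> > 0" "\<And>x v. v \<in> F x \<Longrightarrow> norm v \<le> \<gamma> * (1 + norm x)"
    using assumption_F_growth[OF F] by blast
  have "continuous_on {0..T} f"
    using f unfolding trajectory_def by (blast intro: abs_continuous_imp_continuous_on)
  then have "bounded (f ` {0..T})"
    by (intro compact_imp_bounded compact_continuous_image) auto
  then obtain R where R: "R > 0" "\<And>t. t \<in> {0..T} \<Longrightarrow> norm (f t) \<le> R"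
    by (auto simp: bounded_pos)
  have speed: "norm v \<le> \<gamma> * (1 + R)" if "t \<in> {0..T}" "v \<in> F (f t)" for t v
    using \<gamma>(2)[OF that(2)] R(2)[OF that(1)] \<gamma>(1)
    by (meson add_left_mono less_imp_le mult_left_mono order_trans)
  have "(\<gamma> * (1 + R))-lipschitz_on {0..T} f"
  proof (rule lipschitz_on_leI)
    fix s t assume "s \<in> {0..T}" "t \<in> {0..T}" "s \<le> t"
    then have "norm (f t - f s) \<le> \<gamma> * (1 + R) * (t - s)"
      using \<gamma>(1) R(1) by (intro trajectory_norm_increment_le[OF f] speed) auto
    with \<open>s \<le> t\<close> show "dist (f s) (f t) \<le> \<gamma> * (1 + R) * dist s t"
      by (simp add: dist_norm norm_minus_commute)
  qed (use \<gamma> R in auto)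
  then show ?thesis by (rule that)
qed

text \<open>A short-time substitute for Gronwall's inequality: the maximal displacement
  \<open>R\<close> on \<open>{0..s}\<close> satisfies
  \<open>R \<le> \<gamma> * (1 + norm x + R) * s\<close>, and the smallness of
  \<open>\<gamma> * s\<close> lets half of \<open>R\<close> be absorbed on the left.\<close>

lemma trajectory_displacement_le:
  assumes f: "trajectory F x T f"
    and \<gamma>: "\<gamma> > 0" "\<And>x v. v \<in> F x \<Longrightarrow> norm v \<le> \<gamma> * (1 + norm x)"
    and s: "0 \<le> s" "s \<le> T" "\<gamma> * s \<le> 1 / 2"
  shows "norm (f s - x) \<le> 2 * \<gamma> * (1 + norm x) * s"
proof -
  have f0: "f 0 = x" using f by (simp add: trajectory_def)
  have "continuous_on {0..T} f"
    using f unfolding trajectory_def by (blast intro: abs_continuous_imp_continuous_on)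
  then have "continuous_on {0..s} (\<lambda>t. norm (f t - x))"
    using s by (intro continuous_intros) (auto elim: continuous_on_subset)
  then obtain u where u: "u \<in> {0..s}" "\<And>t. t \<in> {0..s} \<Longrightarrow> norm (f t - x) \<le> norm (f u - x)"
    using continuous_attains_sup[of "{0..s}" "\<lambda>t. norm (f t - x)"] s by auto
  define R where "R = norm (f u - x)"
  have "norm v \<le> \<gamma> * (1 + norm x + R)" if "t \<in> {0..u}" "v \<in> F (f t)" for t v
  proof -
    have "norm (f t) \<le> norm x + R"
      using u(2)[of t] that(1) u(1) norm_triangle_sub[of "f t" x] by (auto simp: R_def)
    then show ?thesis
      using \<gamma>(2)[OF that(2)] \<gamma>(1) by (smt (verit) mult_left_mono)
  qed
  then have "R \<le> \<gamma> * (1 + norm x + R) * u"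
    using trajectory_norm_increment_le[OF f, of 0 u "\<gamma> * (1 + norm x + R)"] u s \<gamma>(1)
    by (simp add: f0 R_def)
  also have "\<dots> \<le> \<gamma> * (1 + norm x + R) * s"
    using u(1) \<gamma>(1) by (intro mult_left_mono) (auto simp: R_def)
  also have "\<dots> \<le> \<gamma> * (1 + norm x) * s + R / 2"
    using mult_right_mono[OF s(3), of R] by (simp add: R_def algebra_simps)
  finally have "R \<le> 2 * \<gamma> * (1 + norm x) * s" by simp
  with u(2)[of s] s(1) show ?thesis by (simp add: R_def)
qed

section \<open>Time shift and concatenation of trajectories\<close>

lemma trajectory_shift:
  assumes F: "assumption_F F" and f: "trajectory F x T f" and s: "0 \<le> s" "s \<le> T"
  shows "trajectory F (f s) (T - s) (\<lambda>t. f (s + t))"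
proof -
  obtain M where M: "M-lipschitz_on {0..T} f"
    using trajectory_imp_lipschitz_on[OF F f] by blast
  obtain N where N: "negligible N"
    "\<And>t. t \<in> {0..T} - N \<Longrightarrow> \<exists>v\<in>F (f t). (f has_vector_derivative v) (at t within {0..T})"
    using trajectory_derivative[OF f] by blast
  show ?thesis
  proof (rule trajectoryI)
    show "M-lipschitz_on {0..T - s} (\<lambda>t. f (s + t))"
    proof (rule lipschitz_onI)
      fix t u assume "t \<in> {0..T - s}" "u \<in> {0..T - s}"
      then show "dist (f (s + t)) (f (s + u)) \<le> M * dist t u"
        using lipschitz_onD[OF M, of "s + t" "s + u"] s by auto
    qed (rule lipschitz_on_nonneg[OF M])
    show "negligible ((+) (- s) ` N)"
      using N(1) by (rule negligible_translation)
    fix t assume t: "t \<in> {0..T - s} - (+) (- s) ` N"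
    then have "s + t \<notin> N" by force
    then obtain v where v: "v \<in> F (f (s + t))" "(f has_vector_derivative v) (at (s + t) within {0..T})"
      using N(2)[of "s + t"] t s by auto
    have img: "(+) s ` {0..T - s} \<subseteq> {0..T}" using s by auto
    have "((+) s has_vector_derivative 1) (at t within {0..T - s})"
      by (auto intro!: derivative_eq_intros)
    moreover have "(f has_vector_derivative v) (at (s + t) within (+) s ` {0..T - s})"
      using v(2) img by (rule has_vector_derivative_within_subset)
    ultimately have "(f \<circ> (+) s has_vector_derivative 1 *\<^sub>R v) (at t within {0..T - s})"
      by (rule vector_diff_chain_within)
    with v(1) show "\<exists>v\<in>F (f (s + t)). ((\<lambda>t. f (s + t)) has_vector_derivative v) (at t within {0..T - s})"
      by (auto simp: o_def)
  qed simp
qed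

lemma trajectory_append:
  assumes F: "assumption_F F" and f: "trajectory F x S f" and g: "trajectory F (f S) T g"
    and ST: "0 \<le> S" "0 \<le> T"
  shows "trajectory F x (S + T) (\<lambda>t. if t \<le> S then f t else g (t - S))"
    (is "trajectory F x _ ?h")
proof -
  obtain M\<^sub>f where Mf: "M\<^sub>f-lipschitz_on {0..S} f"
    using trajectory_imp_lipschitz_on[OF F f] by blast
  obtain M\<^sub>g where Mg: "M\<^sub>g-lipschitz_on {0..T} g"
    using trajectory_imp_lipschitz_on[OF F g] by blast
  obtain N\<^sub>f where Nf: "negligible N\<^sub>f"
    "\<And>t. t \<in> {0..S} - N\<^sub>f \<Longrightarrow> \<exists>v\<in>F (f t). (f has_vector_derivative v) (at t within {0..S})"
    using trajectory_derivative[OF f] by blast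
  obtain N\<^sub>g where Ng: "negligible N\<^sub>g"
    "\<And>t. t \<in> {0..T} - N\<^sub>g \<Longrightarrow> \<exists>v\<in>F (g t). (g has_vector_derivative v) (at t within {0..T})"
    using trajectory_derivative[OF g] by blast
  define M where "M = max M\<^sub>f M\<^sub>g"
  have "M-lipschitz_on {0..S} f"
    using Mf by (rule lipschitz_on_mono) (auto simp: M_def)
  moreover have "M-lipschitz_on {S..S + T} (\<lambda>t. g (t - S))"
  proof (rule lipschitz_onI)
    fix t u assume "t \<in> {S..S + T}" "u \<in> {S..S + T}"
    then have "dist (g (t - S)) (g (u - S)) \<le> M\<^sub>g * dist t u"
      using lipschitz_onD[OF Mg, of "t - S" "u - S"] by (auto simp: dist_real_def)
    also have "\<dots> \<le> M * dist t u" by (intro mult_right_mono) (auto simp: M_def)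
    finally show "dist (g (t - S)) (g (u - S)) \<le> M * dist t u" .
  qed (use lipschitz_on_nonneg[OF Mf] in \<open>simp add: M_def\<close>)
  moreover have gS: "f S = g (S - S)"
    using g by (simp add: trajectory_def)
  ultimately have lip: "M-lipschitz_on {0..S + T} ?h"
    by (rule lipschitz_on_concat)
  show ?thesis
  proof (rule trajectoryI[OF lip])
    show "?h 0 = x" using ST f by (simp add: trajectory_def)
    \<comment> \<open>The junction time \<open>S\<close>, where the two one-sided velocities may
      differ, joins the exceptional set.\<close>
    show "negligible (insert S (N\<^sub>f \<union> (+) S ` N\<^sub>g))"
      using Nf(1) Ng(1) by (auto intro: negligible_translation)
    fix t assume t: "t \<in> {0..S + T} - insert S (N\<^sub>f \<union> (+) S ` N\<^sub>g)"
    show "\<exists>v\<in>F (?h t). (?h has_vector_derivative v) (at t within {0..S + T})"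
    proof (cases "t < S")
      case True
      then obtain v where v: "v \<in> F (f t)" "(f has_vector_derivative v) (at t within {0..S})"
        using Nf(2)[of t] t by auto
      have "at t within {0..S + T} = at t within {0..S}"
        by (rule at_within_nhd[of t "{..<S}"]) (use True ST in auto)
      moreover have "(?h has_vector_derivative v) (at t within {0..S})"
        using v(2) by (rule has_vector_derivative_transform[rotated 2]) (use t True in auto)
      ultimately show ?thesis using v(1) True by auto
    next
      case False
      then have "S < t" using t by auto
      have "t - S \<notin> N\<^sub>g" using t by force
      then obtain v where v: "v \<in> F (g (t - S))" "(g has_vector_derivative v) (at (t - S) within {0..T})"
        using Ng(2)[of "t - S"] t \<open>S < t\<close> by auto
      have "at t within {0..S + T} = at t within {S..S + T}"
        by (rule at_within_nhd[of t "{S<..}"]) (use \<open>S < t\<close> ST in auto)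
      moreover have "(?h has_vector_derivative v) (at t within {S..S + T})"
      proof (rule has_vector_derivative_transform)
        have "((\<lambda>t. t - S) has_vector_derivative 1) (at t within {S..S + T})"
          by (auto intro!: derivative_eq_intros)
        moreover have "(g has_vector_derivative v) (at (t - S) within (\<lambda>t. t - S) ` {S..S + T})"
          using v(2) by (rule has_vector_derivative_within_subset) auto
        ultimately have "(g \<circ> (\<lambda>t. t - S) has_vector_derivative 1 *\<^sub>R v) (at t within {S..S + T})"
          by (rule vector_diff_chain_within)
        then show "((\<lambda>t. g (t - S)) has_vector_derivative v) (at t within {S..S + T})"
          by (simp add: o_def)
      qed (use t \<open>S < t\<close> gS in auto)
      ultimately show ?thesis using v(1) \<open>S < t\<close> by auto
    qed
  qed
qed

section \<open>Trajectories with prescribed endpoint and terminal velocity\<close>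

text \<open>Projection onto a convex set is Hoelder continuous of order 1/2 in the set, for the
  Hausdorff distance. The projection inequality on each set is tested at a point within
  \<open>d\<close> of the other projection, and the two are added.\<close>

lemma closest_point_perturb_set:
  fixes A B :: "'a::euclidean_space set"
  assumes A: "convex A" "closed A" "A \<noteq> {}" and B: "convex B" "closed B" "B \<noteq> {}"
    and AB: "\<And>p. p \<in> A \<Longrightarrow> \<exists>q\<in>B. norm (p - q) \<le> d" and BA: "\<And>q. q \<in> B \<Longrightarrow> \<exists>p\<in>A. norm (q - p) \<le> d"
  shows "(norm (closest_point A a - closest_point B a))\<^sup>2
    \<le> d * (norm (a - closest_point A a) + norm (a - closest_point B a))"
proof -
  let ?P = "closest_point A a" and ?Q = "closest_point B a"
  have "?P \<in> A" "?Q \<in> B"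
    using closest_point_in_set A B by auto
  then obtain p q where p: "p \<in> A" "norm (?Q - p) \<le> d" and q: "q \<in> B" "norm (?P - q) \<le> d"
    using AB BA by meson
  have "(norm (?P - ?Q))\<^sup>2 = (a - ?P) \<bullet> (?Q - ?P) + (a - ?Q) \<bullet> (?P - ?Q)"
    by (simp add: power2_norm_eq_inner inner_diff_left inner_diff_right inner_commute)
  also have "(a - ?P) \<bullet> (?Q - ?P) = (a - ?P) \<bullet> (?Q - p) + (a - ?P) \<bullet> (p - ?P)"
    by (simp add: inner_diff_right)
  also have "(a - ?Q) \<bullet> (?P - ?Q) = (a - ?Q) \<bullet> (?P - q) + (a - ?Q) \<bullet> (q - ?Q)"
    by (simp add: inner_diff_right)
  also have "(a - ?P) \<bullet> (p - ?P) \<le> 0"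
    using closest_point_dot A p by blast
  also have "(a - ?Q) \<bullet> (q - ?Q) \<le> 0"
    using closest_point_dot B q by blast
  also have "(a - ?P) \<bullet> (?Q - p) \<le> norm (a - ?P) * d"
    using p(2) by (rule inner_le_norm_mult)
  also have "(a - ?Q) \<bullet> (?P - q) \<le> norm (a - ?Q) * d"
    using q(2) by (rule inner_le_norm_mult)
  finally show ?thesis by (simp add: algebra_simps)
qed

text \<open>This makes every iterate of the successive approximation below continuous, hence
  integrable. Moving the projected point costs at most its displacement, since projection is
  nonexpansive; moving the set costs the square root from
  \<open>closest_point_perturb_set\<close>.\<close>

lemma continuous_on_closest_point_multifunction:
  fixes F :: "'b::real_normed_vector \<Rightarrow> 'a::euclidean_space set"
  assumes F: "\<And>z. z \<in> Q \<Longrightarrow> convex (F z) \<and> closed (F z) \<and> F z \<noteq> {}"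
    and bnd: "\<And>z v. z \<in> Q \<Longrightarrow> v \<in> F z \<Longrightarrow> norm v \<le> M"
    and lip: "\<And>y z v. y \<in> Q \<Longrightarrow> z \<in> Q \<Longrightarrow> v \<in> F y \<Longrightarrow> \<exists>w\<in>F z. norm (v - w) \<le> L * norm (y - z)"
    and X: "continuous_on I X" "X ` I \<subseteq> Q" and V: "continuous_on I V"
  shows "continuous_on I (\<lambda>t. closest_point (F (X t)) (V t))"
  unfolding continuous_on_def
proof
  fix t assume t: "t \<in> I"
  let ?P = "\<lambda>s u. closest_point (F (X s)) (V u)"
  let ?b = "\<lambda>s. norm (V s - V t) + sqrt (L * norm (X s - X t) * (2 * norm (V t) + 2 * M))"
  have bound: "norm (?P s s - ?P t t) \<le> ?b s" if s: "s \<in> I" for s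
  proof -
    have Q: "X s \<in> Q" "X t \<in> Q" using X(2) s t by auto
    have mem: "?P s t \<in> F (X s)" "?P t t \<in> F (X t)"
      using F Q closest_point_in_set by blast+
    have 1: "norm (?P s s - ?P s t) \<le> norm (V s - V t)"
      using closest_point_lipschitz F[OF Q(1)] by (metis dist_norm)
    have "(norm (?P s t - ?P t t))\<^sup>2 \<le> L * norm (X s - X t) * (norm (V t - ?P s t) + norm (V t - ?P t t))"
      using F[OF Q(1)] F[OF Q(2)] lip[OF Q] lip[OF Q(2,1)]
      by (intro closest_point_perturb_set) (auto simp: norm_minus_commute)
    also have "\<dots> \<le> L * norm (X s - X t) * (2 * norm (V t) + 2 * M)"
    proof (rule mult_left_mono)
      show "norm (V t - ?P s t) + norm (V t - ?P t t) \<le> 2 * norm (V t) + 2 * M"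
        using norm_triangle_ineq4[of "V t" "?P s t"] norm_triangle_ineq4[of "V t" "?P t t"]
          bnd[OF Q(1) mem(1)] bnd[OF Q(2) mem(2)] by linarith
      \<comment> \<open>No sign of \<open>L\<close> is assumed; the product is nonnegative because
        \<open>lip\<close> makes it an upper bound for a norm.\<close>
      show "0 \<le> L * norm (X s - X t)"
        using lip[OF Q mem(1)] norm_ge_zero order_trans by blast
    qed
    finally have "norm (?P s t - ?P t t) \<le> sqrt (L * norm (X s - X t) * (2 * norm (V t) + 2 * M))"
      by (rule real_le_rsqrt)
    with 1 norm_triangle_ineq[of "?P s s - ?P s t" "?P s t - ?P t t"] show ?thesis by simp
  qed
  have "(X \<longlongrightarrow> X t) (at t within I)" "(V \<longlongrightarrow> V t) (at t within I)"
    using X(1) V t by (auto simp: continuous_on_def)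
  then have "(?b \<longlongrightarrow> norm (V t - V t) + sqrt (L * norm (X t - X t) * (2 * norm (V t) + 2 * M))) (at t within I)"
    by (intro tendsto_intros)
  then have "(?b \<longlongrightarrow> 0) (at t within I)" by simp
  moreover have "\<forall>\<^sub>F s in at t within I. norm (?P s s - ?P t t) \<le> ?b s"
    using bound by (auto simp: eventually_at_filter)
  ultimately have "((\<lambda>s. ?P s s - ?P t t) \<longlongrightarrow> 0) (at t within I)"
    by (rule Lim_null_comparison[rotated])
  then show "((\<lambda>s. ?P s s) \<longlongrightarrow> ?P t t) (at t within I)"
    by (simp add: LIM_zero_iff)
qed

lemma norm_closest_point_diff_le:
  assumes "closed S" "\<exists>w\<in>S. norm (v - w) \<le> r"
  shows "norm (closest_point S v - v) \<le> r"
  using assms closest_point_le[of S _ v]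
  by (metis dist_commute dist_norm order_trans)

text \<open>Filippov's successive approximation, run backward from the endpoint: each velocity is the
  projection of the previous one onto the values of \<open>F\<close> along the previous path, which keeps all
  velocities continuous and close to \<open>v\<close>.\<close>

lemma trajectory_to_point_exists:
  fixes F :: "'a::euclidean_space \<Rightarrow> 'a set"
  assumes F: "assumption_F F" and v: "v \<in> F x" and "0 < L"
    and bnd: "\<And>z w. z \<in> cball x 1 \<Longrightarrow> w \<in> F z \<Longrightarrow> norm w \<le> M"
    and lip: "\<And>y z v. y \<in> cball x 1 \<Longrightarrow> z \<in> cball x 1 \<Longrightarrow> v \<in> F y \<Longrightarrow>
      \<exists>w\<in>F z. norm (v - w) \<le> L * norm (y - z)"
    and s: "0 \<le> s" "norm (y - x) + M * s \<le> 1" "L * s \<le> 1 / 2"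
  obtains z f where "trajectory F z s f" "f s = y"
    "norm (z - y + s *\<^sub>R v) \<le> 2 * L * s * (norm (y - x) + M * s)"
proof -
  have Fval: "convex (F z)" "closed (F z)" "F z \<noteq> {}" for z
    using assumption_F_values[OF F] compact_imp_closed by auto
  have M: "0 \<le> M" using bnd[of x v] v norm_ge_zero order_trans by (metis centre_in_cball zero_le_one)
  let ?I = "{0..s}"
  \<comment> \<open>The parameter \<open>t\<close> is time elapsed backward from \<open>y\<close>:
    the n-th path \<open>X n\<close> starts at \<open>y\<close> and has derivative
    \<open>- V n\<close>. The iteration starts from the constant velocity \<open>v\<close>.\<close>
  define V where "V = rec_nat (\<lambda>_::real. v) (\<lambda>n w t. closest_point (F (y - integral {0..t} w)) (w t))"
  define X where "X n t = y - integral {0..t} (V n)" for n :: nat and t :: real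
  have V0: "V 0 t = v" and VS: "V (Suc n) t = closest_point (F (X n t)) (V n t)" for n and t :: real
    by (simp_all add: V_def X_def)
  have X_cont: "continuous_on ?I (\<lambda>t. y - integral {0..t} w)" if "continuous_on ?I w" for w
    using that by (intro continuous_intros indefinite_integral_continuous_1 integrable_continuous_real)
  have intble: "w integrable_on {0..t}" if "continuous_on ?I w" "t \<in> ?I" for t and w :: "real \<Rightarrow> 'a"
    using that by (intro integrable_continuous_real) (auto elim: continuous_on_subset)
  have int_le: "norm (integral {0..t} w) \<le> B * s"
    if w: "continuous_on ?I w" "\<And>u. u \<in> ?I \<Longrightarrow> norm (w u) \<le> B" "t \<in> ?I" for t B and w :: "real \<Rightarrow> 'a"
  proof -
    have "0 \<le> B" using w(2)[of t] w(3) norm_ge_zero order_trans by blast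
    have "norm (integral {0..t} w) \<le> B * (t - 0)"
      using w by (intro integral_bound) (auto elim: continuous_on_subset)
    also have "\<dots> \<le> B * s" using \<open>0 \<le> B\<close> w(3) by (intro mult_left_mono) auto
    finally show ?thesis .
  qed
  have in_ball: "y - integral {0..t} w \<in> cball x 1 \<and> norm (x - (y - integral {0..t} w)) \<le> norm (y - x) + M * s"
    if "continuous_on ?I w" "\<And>u. u \<in> ?I \<Longrightarrow> norm (w u) \<le> M" "t \<in> ?I" for t w
  proof -
    have "norm (x - (y - integral {0..t} w)) \<le> norm (y - x) + M * s"
      using int_le[OF that] norm_triangle_ineq[of "x - y" "integral {0..t} w"]
      by (simp add: norm_minus_commute algebra_simps)
    with s(2) show ?thesis by (simp add: dist_norm)
  qed
  have V_inv: "continuous_on ?I (V n) \<and> (\<forall>t\<in>?I. norm (V n t) \<le> M)" for n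
  proof (induction n)
    case 0
    show ?case using bnd[of x v] v by (simp add: V0[abs_def])
  next
    case (Suc n)
    have Q: "X n ` ?I \<subseteq> cball x 1" using in_ball Suc by (auto simp: X_def)
    have "continuous_on ?I (\<lambda>t. closest_point (F (X n t)) (V n t))"
    proof (rule continuous_on_closest_point_multifunction[of "cball x 1"])
      show "continuous_on ?I (X n)" using X_cont Suc by (simp add: X_def[abs_def])
    qed (use Fval Suc Q in \<open>auto intro: bnd lip\<close>)
    moreover have "norm (closest_point (F (X n t)) (V n t)) \<le> M" if "t \<in> ?I" for t
      using bnd closest_point_in_set[OF Fval(2,3)] Q that by blast
    ultimately show ?case by (simp add: VS[abs_def])
  qed
  then have V_cont: "continuous_on ?I (V n)" and V_bnd: "\<And>t. t \<in> ?I \<Longrightarrow> norm (V n t) \<le> M" for n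
    by auto
  have X_ball: "X n t \<in> cball x 1" "norm (x - X n t) \<le> norm (y - x) + M * s" if "t \<in> ?I" for n t
    using in_ball[OF V_cont V_bnd that] by (auto simp: X_def)
  \<comment> \<open>\<open>C\<close> bounds the first correction: \<open>v\<close> belongs to
    \<open>F x\<close>, and the first path stays within \<open>norm (y - x) + M * s\<close> of
    \<open>x\<close>. Each later correction is at most half the one before, as integration
    contributes a factor \<open>s\<close>, the Lipschitz property a factor \<open>L\<close>, and
    \<open>L * s \<le> 1 / 2\<close>.\<close>
  define C where "C = L * (norm (y - x) + M * s)"
  have C: "0 \<le> C" using M s(1) \<open>0 < L\<close> by (simp add: C_def)
  have V_diff: "\<forall>t\<in>?I. norm (V (Suc n) t - V n t) \<le> C * (1 / 2) ^ n" for n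
  proof (induction n)
    case 0
    show ?case
    proof
      fix t assume t: "t \<in> ?I"
      obtain w where "w \<in> F (X 0 t)" "norm (v - w) \<le> L * norm (x - X 0 t)"
        using lip[OF _ X_ball(1)[OF t] v] by auto
      moreover have "L * norm (x - X 0 t) \<le> C"
        using X_ball(2)[OF t] \<open>0 < L\<close> by (simp add: C_def)
      ultimately show "norm (V (Suc 0) t - V 0 t) \<le> C * (1 / 2) ^ 0"
        unfolding VS V0 using Fval(2) by (intro norm_closest_point_diff_le) force+
    qed
  next
    case (Suc n)
    show ?case
    proof
      fix t assume t: "t \<in> ?I"
      have VF: "V (Suc n) t \<in> F (X n t)"
        using closest_point_in_set[OF Fval(2,3)] by (simp add: VS)
      have "X n t - X (Suc n) t = integral {0..t} (\<lambda>u. V (Suc n) u - V n u)"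
        unfolding X_def by (simp add: integral_diff[OF intble[OF V_cont t] intble[OF V_cont t]])
      then have "norm (X n t - X (Suc n) t) \<le> C * (1 / 2) ^ n * s"
        using int_le[OF continuous_on_diff[OF V_cont V_cont] _ t] Suc by auto
      then have "L * norm (X n t - X (Suc n) t) \<le> L * (C * (1 / 2) ^ n * s)"
        using \<open>0 < L\<close> by simp
      also have "\<dots> = (L * s) * (C * (1 / 2) ^ n)" by simp
      also have "\<dots> \<le> 1 / 2 * (C * (1 / 2) ^ n)"
        using s(3) C by (intro mult_right_mono) auto
      finally have "L * norm (X n t - X (Suc n) t) \<le> C * (1 / 2) ^ Suc n" by simp
      then show "norm (V (Suc (Suc n)) t - V (Suc n) t) \<le> C * (1 / 2) ^ Suc n"
        unfolding VS[of "Suc n"]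
        using lip[OF X_ball(1)[OF t] X_ball(1)[OF t] VF] Fval(2)
        by (intro norm_closest_point_diff_le) force+
    qed
  qed
  \<comment> \<open>The limit velocity is the telescoping series of corrections, which converges
    uniformly by comparison with a geometric series.\<close>
  define W where "W t = (\<Sum>i. V (Suc i) t - V i t) + v" for t
  have "uniform_limit ?I (\<lambda>n t. \<Sum>i<n. V (Suc i) t - V i t) (\<lambda>t. \<Sum>i. V (Suc i) t - V i t) sequentially"
    using V_diff by (intro Weierstrass_m_test[of _ _ "\<lambda>n. C * (1 / 2) ^ n"] summable_mult) auto
  then have "uniform_limit ?I (\<lambda>n t. (\<Sum>i<n. V (Suc i) t - V i t) + v) W sequentially"
    unfolding W_def by (intro uniform_limit_intros)
  moreover have "(\<Sum>i<n. V (Suc i) t - V i t) + v = V n t" for n t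
    using sum_lessThan_telescope[of "\<lambda>i. V i t" n] by (simp add: V0)
  ultimately have VW: "uniform_limit ?I V W sequentially" by simp
  have W_cont: "continuous_on ?I W"
    using uniform_limit_theorem[OF _ VW] V_cont by simp
  have VW_t: "(\<lambda>n. V n t) \<longlonglongrightarrow> W t" if "t \<in> ?I" for t
    using VW that by (rule tendsto_uniform_limitI)
  have W_bnd: "norm (W t) \<le> M" if "t \<in> ?I" for t
    using tendsto_upperbound[OF tendsto_norm[OF VW_t[OF that]]] V_bnd[OF that] by auto
  \<comment> \<open>The bound is the exact partial sum of the series with terms
    \<open>C * (1 / 2) ^ i\<close>; it stays below \<open>2 * C\<close>.\<close>
  have V_v: "norm (V n t - v) \<le> C * (2 - 2 * (1 / 2) ^ n)" if "t \<in> ?I" for n t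
  proof (induction n)
    case (Suc n)
    have "norm (V (Suc n) t - v) \<le> norm (V (Suc n) t - V n t) + norm (V n t - v)"
      using norm_triangle_ineq[of "V (Suc n) t - V n t" "V n t - v"] by simp
    also have "\<dots> \<le> C * (1 / 2) ^ n + C * (2 - 2 * (1 / 2) ^ n)"
      using V_diff that Suc by (intro add_mono) auto
    also have "\<dots> = C * (2 - 2 * (1 / 2) ^ Suc n)" by (simp add: algebra_simps)
    finally show ?case .
  qed (simp add: V0)
  have W_v: "norm (W t - v) \<le> 2 * C" if "t \<in> ?I" for t
  proof (rule tendsto_upperbound[OF tendsto_norm[OF tendsto_diff[OF VW_t[OF that] tendsto_const]]])
    have "C * (2 - 2 * (1 / 2) ^ n) \<le> 2 * C" for n
      using C by (simp add: algebra_simps)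
    then show "\<forall>\<^sub>F n in sequentially. norm (V n t - v) \<le> 2 * C"
      using V_v[OF that] order_trans by (intro always_eventually) blast
  qed simp
  define Z where "Z t = y - integral {0..t} W" for t
  have Z_ball: "Z t \<in> cball x 1" if "t \<in> ?I" for t
    using in_ball[OF W_cont W_bnd that] by (auto simp: Z_def)
  have XZ: "(\<lambda>n. X n t - Z t) \<longlonglongrightarrow> 0" if t: "t \<in> ?I" for t
  proof (rule tendstoI)
    fix e :: real assume "e > 0"
    then have "e / (s + 1) > 0" using s(1) by simp
    from uniform_limitD[OF VW this]
    show "\<forall>\<^sub>F n in sequentially. dist (X n t - Z t) 0 < e"
    proof eventually_elim
      case (elim n)
      have "X n t - Z t = integral {0..t} (\<lambda>u. W u - V n u)"
        unfolding X_def Z_def by (simp add: integral_diff[OF intble[OF W_cont t] intble[OF V_cont t]])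
      also have "norm \<dots> \<le> e / (s + 1) * s"
        using elim by (intro int_le[OF continuous_on_diff[OF W_cont V_cont] _ t])
          (auto simp: dist_norm norm_minus_commute less_imp_le)
      also have "\<dots> < e" using \<open>e > 0\<close> s(1) by (simp add: field_simps)
      finally show ?case by simp
    qed
  qed
  \<comment> \<open>The velocity \<open>V (Suc n) t\<close> lies in \<open>F (X n t)\<close>, so it
    has an approximant \<open>w n\<close> in the fixed closed set \<open>F (Z t)\<close>, with error
    vanishing as the paths converge. Both sequences therefore tend to \<open>W t\<close>.\<close>
  have W_F: "W t \<in> F (Z t)" if t: "t \<in> ?I" for t
  proof -
    have "V (Suc n) t \<in> F (X n t)" for n
      using closest_point_in_set[OF Fval(2,3)] by (simp add: VS)
    then have "\<exists>w\<in>F (Z t). norm (V (Suc n) t - w) \<le> L * norm (X n t - Z t)" for n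
      using lip[OF X_ball(1)[OF t] Z_ball[OF t]] by blast
    then obtain w where w: "\<And>n. w n \<in> F (Z t)" "\<And>n. norm (V (Suc n) t - w n) \<le> L * norm (X n t - Z t)"
      by metis
    have "(\<lambda>n. L * norm (X n t - Z t)) \<longlonglongrightarrow> 0"
      using tendsto_mult_right_zero[OF tendsto_norm_zero[OF XZ[OF t]]] .
    moreover have "\<forall>\<^sub>F n in sequentially. norm (V (Suc n) t - w n) \<le> L * norm (X n t - Z t)"
      using w(2) by simp
    ultimately have "(\<lambda>n. V (Suc n) t - w n) \<longlonglongrightarrow> 0"
      by (rule Lim_null_comparison[rotated])
    from tendsto_diff[OF LIMSEQ_Suc[OF VW_t[OF t]] this]
    have "w \<longlonglongrightarrow> W t" by simp
    then show ?thesis using closed_sequentially[OF Fval(2)] w(1) by blast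
  qed
  \<comment> \<open>Reversing time turns the derivative \<open>- W\<close> of \<open>Z\<close> into
    \<open>W\<close>, so the reversed path is a trajectory from \<open>Z s\<close> to
    \<open>y\<close>.\<close>
  have Z_der: "((\<lambda>t. Z (s - t)) has_vector_derivative W (s - t)) (at t within ?I)" if t: "t \<in> ?I" for t
  proof -
    have "((\<lambda>u. s - u) has_vector_derivative - 1) (at t within ?I)"
      by (auto intro!: derivative_eq_intros)
    moreover have "(Z has_vector_derivative - W (s - t)) (at (s - t) within ?I)"
      unfolding Z_def[abs_def] using integral_has_vector_derivative[OF W_cont, of "s - t"] t
      by (auto intro!: derivative_eq_intros)
    then have "(Z has_vector_derivative - W (s - t)) (at (s - t) within (\<lambda>u. s - u) ` ?I)"
      by (rule has_vector_derivative_within_subset) auto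
    ultimately have "(Z \<circ> (\<lambda>u. s - u) has_vector_derivative (- 1) *\<^sub>R (- W (s - t))) (at t within ?I)"
      by (rule vector_diff_chain_within)
    then show ?thesis by (simp add: o_def)
  qed
  have "M-lipschitz_on ?I (\<lambda>t. Z (s - t))"
  proof (rule bounded_derivative_imp_lipschitz)
    fix t assume t: "t \<in> ?I"
    show "((\<lambda>t. Z (s - t)) has_derivative (\<lambda>h. h *\<^sub>R W (s - t))) (at t within ?I)"
      using Z_der[OF t] by (simp add: has_vector_derivative_def)
    have "norm (W (s - t)) \<le> M" using t by (intro W_bnd) auto
    then show "onorm (\<lambda>h. h *\<^sub>R W (s - t)) \<le> M"
      by (intro onorm_bound[OF M]) (simp add: mult.commute[of M] mult_left_mono)
  qed (use M in auto)
  then have "trajectory F (Z s) s (\<lambda>t. Z (s - t))"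
    by (rule trajectoryI[of _ _ _ _ "{}"]) (use W_F Z_der in force)+
  moreover have "Z (s - s) = y" by (simp add: Z_def)
  moreover have "norm (Z s - y + s *\<^sub>R v) \<le> 2 * L * s * (norm (y - x) + M * s)"
  proof -
    have "integral ?I (\<lambda>t. W t - v) = integral ?I W - s *\<^sub>R v"
      using integral_diff[OF intble[OF W_cont, of s] intble[of "\<lambda>_. v" s]] s(1) by simp
    then have "norm (Z s - y + s *\<^sub>R v) = norm (integral ?I (\<lambda>t. W t - v))"
      by (simp add: Z_def norm_minus_commute)
    also have "\<dots> \<le> 2 * C * s"
      using W_v s(1) by (intro int_le continuous_intros W_cont) auto
    finally show ?thesis by (simp add: C_def algebra_simps)
  qed
  ultimately show ?thesis by (rule that)
qed

text \<open>Forward, every velocity met near \<open>x\<close> is close to some element of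
  \<open>F x\<close>, whose product with \<zeta> is at least the Hamiltonian; this holds for all
  trajectories. Backward, one trajectory suffices: it arrives at \<open>y\<close> with velocities
  close to a minimizer of the Hamiltonian in \<open>F x\<close>, so \<open>z - y\<close> is nearly
  \<open>- s\<close> times that minimizer.\<close>

lemma trajectory_local_bounds:
  fixes F :: "'a::euclidean_space \<Rightarrow> 'a set"
  assumes F: "assumption_F F"
  obtains \<delta> C where "\<delta> > 0" "\<delta> \<le> 1" "C \<ge> 0"
    "\<And>y s T f \<zeta>. norm (y - x) \<le> \<delta> \<Longrightarrow> 0 \<le> s \<Longrightarrow> s \<le> \<delta> \<Longrightarrow> s \<le> T \<Longrightarrow> trajectory F y T f \<Longrightarrow>
      norm (f s - y) \<le> C * s \<and>
      s * min_hamiltonian F x \<zeta> - C * norm \<zeta> * s * (norm (y - x) + s) \<le> \<zeta> \<bullet> (f s - y)"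
    "\<And>y s \<zeta>. norm (y - x) \<le> \<delta> \<Longrightarrow> 0 \<le> s \<Longrightarrow> s \<le> \<delta> \<Longrightarrow>
      \<exists>z f. trajectory F z s f \<and> f s = y \<and> norm (z - y) \<le> C * s \<and>
        - s * min_hamiltonian F x \<zeta> - C * norm \<zeta> * s * (norm (y - x) + s) \<le> \<zeta> \<bullet> (z - y)"
proof -
  obtain \<gamma> where \<gamma>: "\<gamma> > 0" "\<And>x v. v \<in> F x \<Longrightarrow> norm v \<le> \<gamma> * (1 + norm x)"
    using assumption_F_growth[OF F] by blast
  obtain L where L: "L > 0" "\<And>y z v. y \<in> cball x 1 \<Longrightarrow> z \<in> cball x 1 \<Longrightarrow> v \<in> F y \<Longrightarrow>
      \<exists>w\<in>F z. norm (v - w) \<le> L * norm (y - z)"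
    using assumption_F_lipschitz[OF F compact_cball] by blast
  \<comment> \<open>On the unit ball around \<open>x\<close>, \<open>M\<close> dominates both the
    speeds and the coefficient from \<open>trajectory_displacement_le\<close>. The choice of
    \<delta> makes \<delta> and its products with \<gamma>, \<open>M\<close> and \<open>L\<close> at
    most 1/2, and \<open>C\<close> covers displacements as well as second-order errors in both time
    directions.\<close>
  define M where "M = 2 * \<gamma> * (2 + norm x)"
  define \<delta> where "\<delta> = 1 / (2 + 2 * \<gamma> + 2 * M + 2 * L)"
  define C where "C = M + 2 * L * (1 + M)"
  have M: "0 < M" using \<gamma>(1) by (simp add: M_def add_pos_nonneg)
  have pos: "0 < 2 + 2 * \<gamma> + 2 * M + 2 * L" using \<gamma>(1) M L(1) by simp
  have \<delta>: "0 < \<delta>" "\<delta> \<le> 1 / 2" "\<gamma> * \<delta> \<le> 1 / 2" "M * \<delta> \<le> 1 / 2" "L * \<delta> \<le> 1 / 2"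
    using \<gamma>(1) M L(1) pos by (auto simp: \<delta>_def divide_le_eq)
  have C: "0 \<le> C" using M L(1) by (simp add: C_def)
  have growth: "2 * \<gamma> * (1 + norm z) \<le> M" if "z \<in> cball x 1" for z
    using that norm_triangle_sub[of z x] \<gamma>(1) by (simp add: M_def dist_norm norm_minus_commute)
  have bnd: "norm w \<le> M" if "z \<in> cball x 1" "w \<in> F z" for z w
  proof -
    have "norm w \<le> \<gamma> * (1 + norm z)" using \<gamma>(2) that(2) by blast
    also have "\<dots> \<le> 2 * \<gamma> * (1 + norm z)" using \<gamma>(1) by simp
    finally show ?thesis using growth[OF that(1)] by simp
  qed
  have dist_le: "L * (r + M * s) \<le> L * (1 + M) * (r + s)" if "0 \<le> r" "0 \<le> s" for r s
    using that M L(1) by (simp add: mult.assoc distrib_left distrib_right)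
  have fwd: "norm (f s - y) \<le> C * s \<and>
      s * min_hamiltonian F x \<zeta> - C * norm \<zeta> * s * (norm (y - x) + s) \<le> \<zeta> \<bullet> (f s - y)"
    if y: "norm (y - x) \<le> \<delta>" and s: "0 \<le> s" "s \<le> \<delta>" "s \<le> T" and f: "trajectory F y T f"
    for y s T f \<zeta>
  proof -
    have y1: "y \<in> cball x 1" using y \<delta>(2) by (simp add: dist_norm norm_minus_commute)
    have disp: "norm (f t - y) \<le> M * t" if "0 \<le> t" "t \<le> s" for t
    proof -
      have "\<gamma> * t \<le> \<gamma> * \<delta>" using that s \<gamma>(1) by simp
      then have "norm (f t - y) \<le> 2 * \<gamma> * (1 + norm y) * t"
        using that s \<delta>(3) by (intro trajectory_displacement_le[OF f \<gamma>]) auto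
      also have "\<dots> \<le> M * t" using growth[OF y1] that by (intro mult_right_mono) auto
      finally show ?thesis .
    qed
    have vel: "(- \<zeta>) \<bullet> v \<le> - min_hamiltonian F x \<zeta> + norm \<zeta> * (L * (norm (y - x) + M * s))"
      if t: "t \<in> {0..s}" and v: "v \<in> F (f t)" for t v
    proof -
      have "norm (f t - x) \<le> norm (y - x) + M * t"
        using disp[of t] t norm_triangle_ineq[of "f t - y" "y - x"] by simp
      also have "M * t \<le> M * s" using t M by simp
      finally have near: "norm (f t - x) \<le> norm (y - x) + M * s" by simp
      moreover have "M * s \<le> 1 / 2"
        using order_trans[OF mult_left_mono[OF s(2)] \<delta>(4)] M by simp
      ultimately have "norm (f t - x) \<le> 1" using y \<delta>(2) by simp
      then have "f t \<in> cball x 1" by (simp add: dist_norm norm_minus_commute)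
      then obtain w where w: "w \<in> F x" "norm (v - w) \<le> L * norm (f t - x)"
        using L(2)[OF _ _ v, of x] by auto
      have "norm (v - w) \<le> L * (norm (y - x) + M * s)"
        using w(2) near L(1) by (meson mult_left_mono less_imp_le order_trans)
      then have "\<zeta> \<bullet> (w - v) \<le> norm \<zeta> * (L * (norm (y - x) + M * s))"
        unfolding norm_minus_commute[of v] by (rule inner_le_norm_mult)
      moreover have "min_hamiltonian F x \<zeta> \<le> \<zeta> \<bullet> w"
        using min_hamiltonian_attained[of F x \<zeta>, OF assumption_F_values(1,3)[OF F]] w(1)
        by (metis inner_commute)
      ultimately show ?thesis by (simp add: inner_diff_right)
    qed
    have f0: "f 0 = y" using f by (simp add: trajectory_def)
    \<comment> \<open>The increment lemma gives upper bounds; the direction \<open>- \<zeta>\<close>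
      converts this into the desired lower bound.\<close>
    have "(- \<zeta>) \<bullet> (f s - f 0) \<le>
        (- min_hamiltonian F x \<zeta> + norm \<zeta> * (L * (norm (y - x) + M * s))) * (s - 0)"
      using s by (intro trajectory_inner_increment_le[OF f] vel) auto
    then have "s * min_hamiltonian F x \<zeta> - norm \<zeta> * s * (L * (norm (y - x) + M * s)) \<le> \<zeta> \<bullet> (f s - y)"
      by (simp add: f0 algebra_simps)
    moreover have "norm \<zeta> * s * (L * (norm (y - x) + M * s)) \<le> norm \<zeta> * s * (C * (norm (y - x) + s))"
    proof (rule mult_left_mono)
      have "L * (1 + M) * (norm (y - x) + s) \<le> C * (norm (y - x) + s)"
        using s M L(1) by (intro mult_right_mono) (auto simp: C_def)
      then show "L * (norm (y - x) + M * s) \<le> C * (norm (y - x) + s)"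
        using dist_le[of "norm (y - x)" s] s(1) by simp
    qed (use s in simp)
    moreover have "M * s \<le> C * s" using s M L(1) by (intro mult_right_mono) (auto simp: C_def)
    ultimately show ?thesis using disp[of s] s by (simp add: algebra_simps)
  qed
  have bwd: "\<exists>z f. trajectory F z s f \<and> f s = y \<and> norm (z - y) \<le> C * s \<and>
        - s * min_hamiltonian F x \<zeta> - C * norm \<zeta> * s * (norm (y - x) + s) \<le> \<zeta> \<bullet> (z - y)"
    if y: "norm (y - x) \<le> \<delta>" and s: "0 \<le> s" "s \<le> \<delta>" for y s \<zeta>
  proof -
    obtain v where v: "v \<in> F x" "min_hamiltonian F x \<zeta> = v \<bullet> \<zeta>"
      using min_hamiltonian_attained[of F x \<zeta>, OF assumption_F_values(1,3)[OF F]] by blast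
    have le1: "norm (y - x) + M * s \<le> 1" "L * s \<le> 1 / 2"
      using y \<delta>(2) order_trans[OF mult_left_mono[OF s(2)] \<delta>(4)] M
        order_trans[OF mult_left_mono[OF s(2)] \<delta>(5)] L(1) by auto
    obtain z f where zf: "trajectory F z s f" "f s = y"
        "norm (z - y + s *\<^sub>R v) \<le> 2 * L * s * (norm (y - x) + M * s)"
      by (rule trajectory_to_point_exists[OF F v(1) L(1) bnd L(2) s(1) le1])
    have "norm (z - y) \<le> norm (z - y + s *\<^sub>R v) + norm (s *\<^sub>R v)"
      using norm_triangle_ineq4[of "z - y + s *\<^sub>R v" "s *\<^sub>R v"] by simp
    also have "\<dots> \<le> 2 * L * s * 1 + s * M"
    proof (rule add_mono)
      show "norm (z - y + s *\<^sub>R v) \<le> 2 * L * s * 1"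
        using s L(1) by (intro order_trans[OF zf(3)] mult_left_mono[OF le1(1)]) simp
      show "norm (s *\<^sub>R v) \<le> s * M"
        using bnd[of x v] v(1) s by (simp add: mult_left_mono)
    qed
    also have "\<dots> = (M + 2 * L * 1) * s" by (simp add: algebra_simps)
    also have "\<dots> \<le> C * s" using s M L(1) by (intro mult_right_mono) (auto simp: C_def)
    finally have "norm (z - y) \<le> C * s" .
    moreover have "- s * min_hamiltonian F x \<zeta> - C * norm \<zeta> * s * (norm (y - x) + s) \<le> \<zeta> \<bullet> (z - y)"
    proof -
      have "2 * L * s * (norm (y - x) + M * s) \<le> 2 * s * (L * (1 + M) * (norm (y - x) + s))"
        using mult_left_mono[OF dist_le[of "norm (y - x)" s], of "2 * s"] s(1) by (simp add: mult_ac)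
      also have "\<dots> = (2 * L * (1 + M)) * (s * (norm (y - x) + s))" by simp
      also have "\<dots> \<le> C * (s * (norm (y - x) + s))"
        using M s by (intro mult_right_mono) (auto simp: C_def)
      finally have "norm (z - y + s *\<^sub>R v) \<le> C * (s * (norm (y - x) + s))" using zf(3) by simp
      then have "(- \<zeta>) \<bullet> (z - y + s *\<^sub>R v) \<le> norm (- \<zeta>) * (C * (s * (norm (y - x) + s)))"
        by (rule inner_le_norm_mult)
      then show ?thesis
        using v(2) by (simp add: inner_add_right inner_commute[of v] algebra_simps)
    qed
    ultimately show ?thesis using zf(1,2) by blast
  qed
  show ?thesis
    by (rule that[of \<delta> C]) (use \<delta>(1,2) C fwd bwd in auto)
qed

section \<open>The minimum time function\<close>

lemma min_time_nonneg: "0 \<le> min_time F K x"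
  by (auto simp: min_time_def intro!: Inf_greatest)

lemma min_time_le:
  assumes "trajectory F x T f" "f T \<in> K" "0 \<le> T"
  shows "min_time F K x \<le> ereal T"
proof (cases "x \<in> K")
  case False
  \<comment> \<open>The infimum ranges over positive times only; a trajectory of duration 0 ending
    in \<open>K\<close> would start in \<open>K\<close>.\<close>
  then have "T \<noteq> 0" using assms by (auto simp: trajectory_def)
  with False assms show ?thesis
    by (auto simp: min_time_def intro!: Inf_lower)
qed (use assms in \<open>simp add: min_time_def\<close>)

text \<open>The only instant is itself a null set, so the differential inclusion is vacuous. This
  lets points of \<open>K\<close> be treated as reaching the target in time 0.\<close>

lemma trajectory_const: "trajectory F x 0 (\<lambda>_. x)"
  by (rule trajectoryI[of 0 _ _ _ "{0}"]) (auto intro!: lipschitz_onI)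

lemma min_time_lessE:
  assumes "min_time F K x < ereal b"
  obtains T f where "0 \<le> T" "T < b" "trajectory F x T f" "f T \<in> K"
proof (cases "x \<in> K")
  case True
  with assms have "0 < b" by (simp add: min_time_def)
  with True show ?thesis using that[of 0 "\<lambda>_. x"] trajectory_const by auto
next
  case False
  with assms obtain T f where "0 < T" "T < b" "trajectory F x T f" "f T \<in> K"
    by (auto simp: min_time_def Inf_less_iff)
  then show ?thesis using that[of T f] by simp
qed

text \<open>One half of the dynamic programming principle: the given arc is followed by an
  \<open>e\<close>-optimal trajectory from its endpoint, and \<open>e\<close> tends to 0.\<close>

lemma min_time_le_add:
  assumes F: "assumption_F F" and f: "trajectory F z s f" "0 \<le> s" and le: "min_time F K (f s) \<le> ereal b"
  shows "min_time F K z \<le> ereal (s + b)"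
proof (rule ereal_le_epsilon2)
  fix e :: real assume "0 < e"
  with le have "min_time F K (f s) < ereal (b + e)"
    by (metis ereal_less_eq(3) le_less_trans less_add_same_cancel1 less_ereal.simps(1) linorder_not_le)
  then obtain T g where g: "0 \<le> T" "T < b + e" "trajectory F (f s) T g" "g T \<in> K"
    by (rule min_time_lessE)
  have g0: "g 0 = f s" using g(3) by (simp add: trajectory_def)
  have "min_time F K z \<le> ereal (s + T)"
    by (rule min_time_le[OF trajectory_append[OF F f(1) g(3) f(2) g(1)]])
      (use g f g0 in \<open>auto\<close>)
  also have "\<dots> \<le> ereal (s + b) + ereal e" using g(2) by simp
  finally show "min_time F K z \<le> ereal (s + b) + ereal e" .
qed

lemma min_time_along_trajectory:
  assumes F: "assumption_F F" and f: "trajectory F y T f" "f T \<in> K" and s: "0 \<le> s" "s \<le> T"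
  shows "min_time F K (f s) \<le> ereal (T - s)"
  by (rule min_time_le[OF trajectory_shift[OF F f(1) s]]) (use f s in auto)

text \<open>A ball of radius \<rho> around \<open>x\<close> misses \<open>K\<close>, and
  trajectories from \<open>x\<close> move at most \<open>C * s\<close> in a short time
  \<open>s\<close>, so a positive time is needed to leave that ball.\<close>

lemma min_time_pos:
  assumes F: "assumption_F F" and "closed K" "x \<notin> K"
  shows "0 < min_time F K x"
proof (rule ccontr)
  assume "\<not> 0 < min_time F K x"
  then have 0: "min_time F K x = 0"
    using min_time_nonneg[of F K x] by simp
  obtain \<rho> where \<rho>: "\<rho> > 0" "ball x \<rho> \<subseteq> - K"
    using assms(2,3) by (metis ComplI open_Compl open_contains_ball)
  obtain \<delta> C where \<delta>: "\<delta> > 0" and C: "C \<ge> 0" and fwd: "\<And>y s T f \<zeta>. norm (y - x) \<le> \<delta> \<Longrightarrow> 0 \<le> s \<Longrightarrow> s \<le> \<delta> \<Longrightarrow>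
      s \<le> T \<Longrightarrow> trajectory F y T f \<Longrightarrow> norm (f s - y) \<le> C * s"
    using trajectory_local_bounds[OF F, of x] by metis
  have "min_time F K x < ereal (min \<delta> (\<rho> / (C + 1)))"
    using 0 \<delta> C \<rho> by (simp add: min_def)
  then obtain T f where T: "0 \<le> T" "T < min \<delta> (\<rho> / (C + 1))" "trajectory F x T f" "f T \<in> K"
    by (rule min_time_lessE)
  have "norm (f T - x) \<le> C * T"
    using fwd[OF _ T(1) _ _ T(3)] T(2) \<delta> by simp
  also have "\<dots> \<le> (C + 1) * T" using T(1) by (simp add: distrib_right)
  also have "\<dots> < \<rho>" using T(2) C by (simp add: field_simps)
  finally have "f T \<in> ball x \<rho>" by (simp add: dist_norm norm_minus_commute)
  with \<rho>(2) T(4) show False by blast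
qed

section \<open>Proximal normals\<close>

text \<open>At distance more than \<delta> the Cauchy-Schwarz inequality already gives the quadratic
  bound, with constant \<open>norm v / \<delta>\<close>.\<close>

lemma proximal_normal_coneI_local:
  assumes "\<delta> > 0" "\<And>y. y \<in> E \<Longrightarrow> norm (y - x) \<le> \<delta> \<Longrightarrow> v \<bullet> (y - x) \<le> \<sigma> * (norm (y - x))\<^sup>2"
  shows "v \<in> proximal_normal_cone E x"
proof -
  define \<sigma>' where "\<sigma>' = max (max 0 \<sigma>) (norm v / \<delta>)"
  have "v \<bullet> (y - x) \<le> \<sigma>' * (norm (y - x))\<^sup>2" if "y \<in> E" for y
  proof (cases "norm (y - x) \<le> \<delta>")
    case True
    then have "v \<bullet> (y - x) \<le> \<sigma> * (norm (y - x))\<^sup>2" using assms(2) that by blast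
    also have "\<dots> \<le> \<sigma>' * (norm (y - x))\<^sup>2" by (intro mult_right_mono) (auto simp: \<sigma>'_def)
    finally show ?thesis .
  next
    case False
    have "v \<bullet> (y - x) \<le> norm v / \<delta> * (\<delta> * norm (y - x))"
      using assms(1) norm_cauchy_schwarz[of v "y - x"] by simp
    also have "\<dots> \<le> norm v / \<delta> * (norm (y - x) * norm (y - x))"
      using assms(1) False by (intro mult_left_mono mult_right_mono) auto
    also have "\<dots> \<le> \<sigma>' * (norm (y - x))\<^sup>2"
      unfolding power2_eq_square by (intro mult_right_mono) (auto simp: \<sigma>'_def)
    finally show ?thesis .
  qed
  moreover have "0 \<le> \<sigma>'" by (simp add: \<sigma>'_def)
  ultimately show ?thesis unfolding proximal_normal_cone_def by blast
qed

text \<open>First-order inequalities with an error of order \<open>s\<close> squared are used in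
  this form, after division by \<open>s\<close>.\<close>

lemma nonpos_if_le_small_multiples:
  fixes a B s\<^sub>0 :: real
  assumes "s\<^sub>0 > 0" "\<And>s. 0 < s \<Longrightarrow> s \<le> s\<^sub>0 \<Longrightarrow> a \<le> B * s"
  shows "a \<le> 0"
proof (rule tendsto_lowerbound)
  have "((\<lambda>s. B * s) \<longlongrightarrow> B * 0) (at_right 0)" by (intro tendsto_intros)
  then show "((\<lambda>s. B * s) \<longlongrightarrow> 0) (at_right 0)" by simp
  show "\<forall>\<^sub>F s in at_right 0. a \<le> B * s"
    using assms by (intro eventually_at_rightI[of 0 s\<^sub>0]) auto
qed simp

lemma mem_epi_min_time: "(y, \<beta>) \<in> epi (min_time F K) \<longleftrightarrow> min_time F K y \<le> ereal \<beta>"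
  by (auto simp: epi_def)

lemma norm_Pair_diff_squared:
  fixes y x :: "'a::real_inner" and \<beta> \<tau> :: real
  shows "(norm ((y, \<beta>) - (x, \<tau>)))\<^sup>2 = (norm (y - x))\<^sup>2 + (\<beta> - \<tau>)\<^sup>2"
  by (simp add: norm_Pair)

lemma epi_normal_of_reachable_normal:
  fixes F :: "'a::euclidean_space \<Rightarrow> 'a set"
  assumes F: "assumption_F F" and \<tau>: "min_time F K x = ereal \<tau>" "0 < \<tau>"
    and \<zeta>: "\<zeta> \<in> proximal_normal_cone (reachable_within F K \<tau>) x"
  shows "(\<zeta>, min_hamiltonian F x \<zeta>) \<in> proximal_normal_cone (epi (min_time F K)) (x, \<tau>)"
proof -
  obtain \<sigma> where \<sigma>: "\<sigma> \<ge> 0" "\<And>y. min_time F K y \<le> ereal \<tau> \<Longrightarrow> \<zeta> \<bullet> (y - x) \<le> \<sigma> * (norm (y - x))\<^sup>2"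
    using \<zeta> unfolding proximal_normal_cone_def reachable_within_def by blast
  define h where "h = min_hamiltonian F x \<zeta>"
  obtain \<delta> C where \<delta>: "\<delta> > 0" "\<delta> \<le> 1" and C: "C \<ge> 0"
    and fwd: "\<And>y s T f. norm (y - x) \<le> \<delta> \<Longrightarrow> 0 \<le> s \<Longrightarrow> s \<le> \<delta> \<Longrightarrow> s \<le> T \<Longrightarrow> trajectory F y T f \<Longrightarrow>
      norm (f s - y) \<le> C * s \<and> s * h - C * norm \<zeta> * s * (norm (y - x) + s) \<le> \<zeta> \<bullet> (f s - y)"
    and bwd: "\<And>y s. norm (y - x) \<le> \<delta> \<Longrightarrow> 0 \<le> s \<Longrightarrow> s \<le> \<delta> \<Longrightarrow>
      \<exists>z f. trajectory F z s f \<and> f s = y \<and> norm (z - y) \<le> C * s \<and>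
        - s * h - C * norm \<zeta> * s * (norm (y - x) + s) \<le> \<zeta> \<bullet> (z - y)"
    using trajectory_local_bounds[OF F, of x] unfolding h_def by metis
  \<comment> \<open>The \<sigma> term comes from \<open>(norm (y - x) + C * s)\<^sup>2 \<le> 2 * (1
    + C\<^sup>2) * ((norm (y - x))\<^sup>2 + s\<^sup>2)\<close>, the other from bounding the mixed
    product \<open>s * (norm (y - x) + s)\<close>.\<close>
  define B where "B = 2 * \<sigma> * (1 + C\<^sup>2) + 2 * C * norm \<zeta>"
  have B: "0 \<le> B" using \<sigma>(1) C by (simp add: B_def)
  \<comment> \<open>The normal inequality at a point \<open>z\<close> of the sublevel set is
    transferred to a nearby \<open>y\<close>; \<open>e\<close> is the first-order part of
    \<open>\<zeta> \<bullet> (z - y)\<close>, namely \<open>s * h\<close>, \<open>- s * h\<close> or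
    0 below.\<close>
  have key: "\<zeta> \<bullet> (y - x) + e \<le> B * ((norm (y - x))\<^sup>2 + s\<^sup>2)"
    if z: "min_time F K z \<le> ereal \<tau>" "0 \<le> s" "norm (z - y) \<le> C * s"
      "e - C * norm \<zeta> * s * (norm (y - x) + s) \<le> \<zeta> \<bullet> (z - y)" for y z s e
  proof -
    let ?r = "norm (y - x)"
    have "norm (z - x) \<le> ?r + C * s"
      using norm_triangle_ineq[of "z - y" "y - x"] z(3) by simp
    then have "(norm (z - x))\<^sup>2 \<le> (?r + C * s)\<^sup>2" by (intro power_mono) auto
    also have "\<dots> \<le> 2 * (1 + C\<^sup>2) * (?r\<^sup>2 + s\<^sup>2)"
    proof -
      have "0 \<le> (?r - C * s)\<^sup>2 + 2 * s\<^sup>2 + 2 * (C * ?r)\<^sup>2" by simp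
      then show ?thesis by (simp add: power2_eq_square algebra_simps)
    qed
    finally have "\<zeta> \<bullet> (z - x) \<le> \<sigma> * (2 * (1 + C\<^sup>2) * (?r\<^sup>2 + s\<^sup>2))"
      using \<sigma>(2)[OF z(1)] \<sigma>(1) by (meson mult_left_mono order_trans)
    moreover have "C * norm \<zeta> * (s * (?r + s)) \<le> C * norm \<zeta> * (2 * (?r\<^sup>2 + s\<^sup>2))"
    proof (rule mult_left_mono)
      have "0 \<le> (?r - s)\<^sup>2 + 3 * ?r\<^sup>2 + s\<^sup>2" by simp
      then show "s * (?r + s) \<le> 2 * (?r\<^sup>2 + s\<^sup>2)" by (simp add: power2_eq_square algebra_simps)
    qed (use C in simp)
    moreover have "\<zeta> \<bullet> (z - x) = \<zeta> \<bullet> (z - y) + \<zeta> \<bullet> (y - x)"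
      by (simp add: inner_diff_right)
    ultimately show ?thesis using z(4) by (simp add: B_def algebra_simps)
  qed
  \<comment> \<open>A nearly optimal trajectory from \<open>x\<close> stays in the sublevel set: its
    total time is below \<open>\<tau> + s\<close>, so less than \<tau> remains after time
    \<open>s\<close>. Testing the normal \<zeta> at that point gives the sign.\<close>
  have "h \<le> 0"
  proof (rule nonpos_if_le_small_multiples)
    show "0 < min \<delta> \<tau>" using \<delta> \<tau> by simp
    fix s assume s: "0 < s" "s \<le> min \<delta> \<tau>"
    have "min_time F K x < ereal (\<tau> + s)" using \<tau> s by simp
    then obtain T f where f: "0 \<le> T" "T < \<tau> + s" "trajectory F x T f" "f T \<in> K"
      by (rule min_time_lessE)
    have "\<tau> \<le> T" using min_time_le[OF f(3,4,1)] \<tau>(1) by simp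
    then have "min_time F K (f s) \<le> ereal (T - s)"
      using s by (intro min_time_along_trajectory[OF F f(3,4)]) auto
    also have "\<dots> \<le> ereal \<tau>" using f(2) by simp
    finally have "\<zeta> \<bullet> (x - x) + s * h \<le> B * ((norm (x - x))\<^sup>2 + s\<^sup>2)"
      using fwd[OF _ _ _ _ f(3), of s] s \<open>\<tau> \<le> T\<close> \<delta> by (intro key) auto
    then show "h \<le> B * s" using s by (simp add: power2_eq_square)
  qed
  \<comment> \<open>The factor 4 comes from \<open>s \<le> 2 * d\<close> in the third case, and
    \<open>\<bar>h\<bar>\<close> pays for the slack \<open>d\<^sup>2\<close> there.\<close>
  have local: "\<zeta> \<bullet> (y - x) + h * (\<beta> - \<tau>) \<le> (4 * B + \<bar>h\<bar>) * ((norm (y - x))\<^sup>2 + (\<beta> - \<tau>)\<^sup>2)"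
    if y: "min_time F K y \<le> ereal \<beta>" "norm (y - x) \<le> \<delta>" and \<beta>: "\<bar>\<beta> - \<tau>\<bar> \<le> \<delta> / 2" for y \<beta>
  proof -
    have weaken: "B * ((norm (y - x))\<^sup>2 + d) \<le> (4 * B + \<bar>h\<bar>) * ((norm (y - x))\<^sup>2 + d)" if "0 \<le> d" for d
      using that B by (intro mult_right_mono) auto
    consider "\<beta> \<le> \<tau>" | "\<tau> < \<beta>" "min_time F K y \<le> ereal \<tau>" | "\<tau> < \<beta>" "ereal \<tau> < min_time F K y"
      by fastforce
    then show ?thesis
    proof cases
      case 1
      obtain z f where zf: "trajectory F z (\<tau> - \<beta>) f" "f (\<tau> - \<beta>) = y" "norm (z - y) \<le> C * (\<tau> - \<beta>)"
        "- (\<tau> - \<beta>) * h - C * norm \<zeta> * (\<tau> - \<beta>) * (norm (y - x) + (\<tau> - \<beta>)) \<le> \<zeta> \<bullet> (z - y)"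
        using bwd[OF y(2), of "\<tau> - \<beta>"] 1 \<beta> \<delta> by auto
      have "min_time F K z \<le> ereal (\<tau> - \<beta> + \<beta>)"
        using 1 y(1) zf(2) by (intro min_time_le_add[OF F zf(1)]) auto
      then have "\<zeta> \<bullet> (y - x) + - (\<tau> - \<beta>) * h \<le> B * ((norm (y - x))\<^sup>2 + (\<tau> - \<beta>)\<^sup>2)"
        using 1 zf by (intro key) auto
      with weaken[of "(\<beta> - \<tau>)\<^sup>2"] show ?thesis
        by (simp add: power2_commute[of \<tau>] algebra_simps)
    next
      case 2
      \<comment> \<open>Here \<open>y\<close> is already in the sublevel set, so
        \<open>z = y\<close> and \<open>s = 0\<close>; the excess \<open>\<beta> - \<tau>\<close>
        only helps because \<open>h \<le> 0\<close>.\<close>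
      have "\<zeta> \<bullet> (y - x) + 0 \<le> B * ((norm (y - x))\<^sup>2 + 0\<^sup>2)"
        using 2 C by (intro key[of y]) auto
      also have "\<dots> \<le> B * ((norm (y - x))\<^sup>2 + (\<beta> - \<tau>)\<^sup>2)"
        using B by (intro mult_left_mono) auto
      moreover have "h * (\<beta> - \<tau>) \<le> 0"
        using \<open>h \<le> 0\<close> 2 by (simp add: mult_nonpos_nonneg)
      ultimately show ?thesis using weaken[of "(\<beta> - \<tau>)\<^sup>2"] by simp
    next
      case 3
      define d where "d = \<beta> - \<tau>"
      have d: "0 < d" "d \<le> \<delta> / 2" "d\<^sup>2 \<le> d"
        using 3 \<beta> \<delta> by (auto simp: d_def power2_eq_square mult_left_le)
      \<comment> \<open>The slack \<open>d\<^sup>2\<close> replaces a minimizing trajectory, whose existence is not needed.\<close>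
      have "min_time F K y < ereal (\<beta> + d\<^sup>2)"
        using y(1) d(1) by (simp add: le_less_trans)
      then obtain T f where f: "0 \<le> T" "T < \<beta> + d\<^sup>2" "trajectory F y T f" "f T \<in> K"
        by (rule min_time_lessE)
      have "ereal \<tau> < ereal T" using 3(2) min_time_le[OF f(3,4,1)] by (rule less_le_trans)
      \<comment> \<open>After time \<open>s\<close> exactly \<tau> remains. As
        \<open>s \<le> d + d\<^sup>2 \<le> 2 * d\<close>, the restriction
        \<open>d \<le> \<delta> / 2\<close> keeps \<open>s\<close> within the range of the local
        bounds.\<close>
      define s where "s = T - \<tau>"
      have s: "0 < s" "s \<le> d + d\<^sup>2" "s \<le> T"
        using \<open>ereal \<tau> < ereal T\<close> f(2) \<tau>(2) by (auto simp: s_def d_def)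
      have "min_time F K (f s) \<le> ereal (T - s)"
        using s by (intro min_time_along_trajectory[OF F f(3,4)]) auto
      then have "\<zeta> \<bullet> (y - x) + s * h \<le> B * ((norm (y - x))\<^sup>2 + s\<^sup>2)"
        using fwd[OF y(2) _ _ s(3) f(3)] s d by (intro key) (auto simp: s_def)
      also have "\<dots> \<le> B * (4 * ((norm (y - x))\<^sup>2 + d\<^sup>2))"
      proof -
        have "s\<^sup>2 \<le> (2 * d)\<^sup>2" using s d by (intro power_mono) auto
        then have "s\<^sup>2 \<le> 4 * d\<^sup>2" by (simp add: power_mult_distrib)
        then have "(norm (y - x))\<^sup>2 + s\<^sup>2 \<le> 4 * ((norm (y - x))\<^sup>2 + d\<^sup>2)"
          by (rule order_trans[OF add_left_mono]) simp
        then show ?thesis using B by (rule mult_left_mono)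
      qed
      finally have "\<zeta> \<bullet> (y - x) + s * h \<le> 4 * B * ((norm (y - x))\<^sup>2 + d\<^sup>2)"
        by (simp add: algebra_simps)
      \<comment> \<open>Since \<open>h \<le> 0\<close>, replacing \<open>s\<close> by its upper
        bound lowers the left side; this isolates \<open>h * d\<close> and leaves the second-order
        term \<open>h * d\<^sup>2\<close>.\<close>
      moreover have "(d + d\<^sup>2) * h \<le> s * h"
        using s(2) \<open>h \<le> 0\<close> by (rule mult_right_mono_neg)
      moreover have "- h * d\<^sup>2 \<le> \<bar>h\<bar> * ((norm (y - x))\<^sup>2 + d\<^sup>2)"
        by (intro mult_mono) auto
      ultimately show ?thesis unfolding d_def[symmetric] by (simp add: algebra_simps)
    qed
  qed
  show ?thesis
  proof (rule proximal_normal_coneI_local)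
    show "0 < \<delta> / 2" using \<delta> by simp
    fix p assume p: "p \<in> epi (min_time F K)" "norm (p - (x, \<tau>)) \<le> \<delta> / 2"
    obtain y \<beta> where yb: "p = (y, \<beta>)" by (cases p)
    have "norm (y - x) \<le> \<delta> / 2" "\<bar>\<beta> - \<tau>\<bar> \<le> \<delta> / 2"
      using p(2) norm_fst_le[of "y - x" "\<beta> - \<tau>"] norm_snd_le[of "\<beta> - \<tau>" "y - x"] by (auto simp: yb)
    then show "(\<zeta>, min_hamiltonian F x \<zeta>) \<bullet> (p - (x, \<tau>)) \<le> (4 * B + \<bar>h\<bar>) * (norm (p - (x, \<tau>)))\<^sup>2"
      using local[of y \<beta>] p(1) \<delta> unfolding yb norm_Pair_diff_squared mem_epi_min_time by (simp add: h_def)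
  qed
qed

text \<open>The epigraph inequality is tested at four kinds of points: vertically above
  \<open>(x, \<tau>)\<close> for the sign of \<alpha>, in the horizontal slice at height \<tau> for
  the normal to the sublevel set, and at points reached from \<open>x\<close> forward and backward
  for the two inequalities between \<alpha> and the Hamiltonian.\<close>

lemma reachable_normal_of_epi_normal:
  fixes F :: "'a::euclidean_space \<Rightarrow> 'a set"
  assumes F: "assumption_F F" and \<tau>: "min_time F K x = ereal \<tau>" "0 < \<tau>"
    and normal: "(\<zeta>, \<alpha>) \<in> proximal_normal_cone (epi (min_time F K)) (x, \<tau>)"
  shows "\<alpha> \<le> 0" "\<zeta> \<in> proximal_normal_cone (reachable_within F K \<tau>) x" "min_hamiltonian F x \<zeta> = \<alpha>"
proof -
  obtain \<sigma> where \<sigma>: "\<sigma> \<ge> 0" "\<And>p. p \<in> epi (min_time F K) \<Longrightarrow>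
      (\<zeta>, \<alpha>) \<bullet> (p - (x, \<tau>)) \<le> \<sigma> * (norm (p - (x, \<tau>)))\<^sup>2"
    using normal unfolding proximal_normal_cone_def by blast
  have ineq: "\<zeta> \<bullet> (y - x) + \<alpha> * (\<beta> - \<tau>) \<le> \<sigma> * ((norm (y - x))\<^sup>2 + (\<beta> - \<tau>)\<^sup>2)"
    if "min_time F K y \<le> ereal \<beta>" for y \<beta>
    using \<sigma>(2)[of "(y, \<beta>)"] that unfolding norm_Pair_diff_squared mem_epi_min_time by simp
  show "\<alpha> \<le> 0"
  proof (rule nonpos_if_le_small_multiples[OF zero_less_one])
    fix s :: real assume "0 < s"
    then show "\<alpha> \<le> \<sigma> * s"
      using ineq[of x "\<tau> + s"] \<tau>(1) by (simp add: power2_eq_square)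
  qed
  show "\<zeta> \<in> proximal_normal_cone (reachable_within F K \<tau>) x"
    using ineq[of _ \<tau>] \<sigma>(1) unfolding proximal_normal_cone_def reachable_within_def by auto
  define h where "h = min_hamiltonian F x \<zeta>"
  obtain \<delta> C where \<delta>: "\<delta> > 0" "\<delta> \<le> 1" and C: "C \<ge> 0"
    and fwd: "\<And>y s T f. norm (y - x) \<le> \<delta> \<Longrightarrow> 0 \<le> s \<Longrightarrow> s \<le> \<delta> \<Longrightarrow> s \<le> T \<Longrightarrow> trajectory F y T f \<Longrightarrow>
      norm (f s - y) \<le> C * s \<and> s * h - C * norm \<zeta> * s * (norm (y - x) + s) \<le> \<zeta> \<bullet> (f s - y)"
    and bwd: "\<And>y s. norm (y - x) \<le> \<delta> \<Longrightarrow> 0 \<le> s \<Longrightarrow> s \<le> \<delta> \<Longrightarrow>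
      \<exists>z f. trajectory F z s f \<and> f s = y \<and> norm (z - y) \<le> C * s \<and>
        - s * h - C * norm \<zeta> * s * (norm (y - x) + s) \<le> \<zeta> \<bullet> (z - y)"
    using trajectory_local_bounds[OF F, of x] unfolding h_def by metis
  have sq: "\<sigma> * ((norm (z - x))\<^sup>2 + b\<^sup>2) \<le> \<sigma> * (C\<^sup>2 + 1) * s\<^sup>2"
    if "norm (z - x) \<le> C * s" "\<bar>b\<bar> \<le> s" for z b s
  proof -
    have "(norm (z - x))\<^sup>2 \<le> (C * s)\<^sup>2" using that(1) by (intro power_mono) auto
    moreover have "b\<^sup>2 \<le> s\<^sup>2" using power_mono[OF that(2), of 2] by simp
    ultimately have "(norm (z - x))\<^sup>2 + b\<^sup>2 \<le> (C\<^sup>2 + 1) * s\<^sup>2"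
      by (simp add: power_mult_distrib distrib_right)
    then show ?thesis using \<sigma>(1) by (simp add: mult_left_mono mult.assoc)
  qed
  have "h - \<alpha> \<le> 0"
  proof (rule nonpos_if_le_small_multiples)
    show "0 < min \<delta> \<tau>" using \<delta> \<tau> by simp
    fix s assume s: "0 < s" "s \<le> min \<delta> \<tau>"
    have s2: "s\<^sup>2 \<le> s" using s \<delta> by (simp add: power2_eq_square mult_left_le)
    \<comment> \<open>A trajectory optimal up to \<open>s\<^sup>2\<close> is enough: that loss only
      changes the coefficient of the second-order error, which disappears in the limit after
      division by \<open>s\<close>.\<close>
    have "min_time F K x < ereal (\<tau> + s\<^sup>2)" using \<tau> s by simp
    then obtain T f where f: "0 \<le> T" "T < \<tau> + s\<^sup>2" "trajectory F x T f" "f T \<in> K"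
      by (rule min_time_lessE)
    have "\<tau> \<le> T" using min_time_le[OF f(3,4,1)] \<tau>(1) by simp
    then have "min_time F K (f s) \<le> ereal (T - s)"
      using s by (intro min_time_along_trajectory[OF F f(3,4)]) auto
    also have "\<dots> \<le> ereal (\<tau> + (s\<^sup>2 - s))" using f(2) by simp
    finally have "\<zeta> \<bullet> (f s - x) + \<alpha> * (s\<^sup>2 - s) \<le> \<sigma> * ((norm (f s - x))\<^sup>2 + (s\<^sup>2 - s)\<^sup>2)"
      using ineq by fastforce
    moreover have fs: "norm (f s - x) \<le> C * s" "s * h - C * norm \<zeta> * s * s \<le> \<zeta> \<bullet> (f s - x)"
      using fwd[OF _ _ _ _ f(3), of s] s \<open>\<tau> \<le> T\<close> \<delta> by auto
    \<comment> \<open>The height change \<open>s\<^sup>2 - s\<close> has absolute value at most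
      \<open>s\<close> because \<open>s \<le> 1\<close>.\<close>
    moreover have "\<sigma> * ((norm (f s - x))\<^sup>2 + (s\<^sup>2 - s)\<^sup>2) \<le> \<sigma> * (C\<^sup>2 + 1) * s\<^sup>2"
      using fs(1) s2 by (intro sq) auto
    ultimately have "s * (h - \<alpha>) \<le> s * ((\<sigma> * (C\<^sup>2 + 1) + C * norm \<zeta> - \<alpha>) * s)"
      by (simp add: power2_eq_square algebra_simps)
    then show "h - \<alpha> \<le> (\<sigma> * (C\<^sup>2 + 1) + C * norm \<zeta> - \<alpha>) * s"
      using s by simp
  qed
  moreover have "\<alpha> - h \<le> 0"
  proof (rule nonpos_if_le_small_multiples[OF \<delta>(1)])
    fix s assume s: "0 < s" "s \<le> \<delta>"
    \<comment> \<open>The backward point \<open>z\<close> reaches \<open>x\<close> in time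
      \<open>s\<close>, so \<open>(z, s + \<tau>)\<close> lies in the epigraph, while
      \<open>\<zeta> \<bullet> (z - x)\<close> is at least \<open>- s * h\<close> up to second
      order.\<close>
    obtain z f where zf: "trajectory F z s f" "f s = x" "norm (z - x) \<le> C * s"
        "- s * h - C * norm \<zeta> * s * s \<le> \<zeta> \<bullet> (z - x)"
      using bwd[of x s] s \<delta> by auto
    have "min_time F K z \<le> ereal (s + \<tau>)"
      using s zf(2) \<tau>(1) by (intro min_time_le_add[OF F zf(1)]) auto
    then have "\<zeta> \<bullet> (z - x) + \<alpha> * s \<le> \<sigma> * ((norm (z - x))\<^sup>2 + s\<^sup>2)"
      using ineq[of z "s + \<tau>"] by simp
    moreover have "\<sigma> * ((norm (z - x))\<^sup>2 + s\<^sup>2) \<le> \<sigma> * (C\<^sup>2 + 1) * s\<^sup>2"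
      using zf(3) s by (intro sq) auto
    ultimately have "s * (\<alpha> - h) \<le> s * ((\<sigma> * (C\<^sup>2 + 1) + C * norm \<zeta>) * s)"
      using zf(4) by (simp add: power2_eq_square algebra_simps)
    then show "\<alpha> - h \<le> (\<sigma> * (C\<^sup>2 + 1) + C * norm \<zeta>) * s"
      using s by simp
  qed
  ultimately show "min_hamiltonian F x \<zeta> = \<alpha>" by (simp add: h_def)
qed

theorem theorem3p5:
  fixes F :: "real ^ 'n \<Rightarrow> (real ^ 'n) set"
    and K :: "(real ^ 'n) set"
    and x :: "real ^ 'n"
  assumes "assumption_F F"
    and "closed K"
    and "x \<in> controllable_set F K - K"
  shows "(\<forall>\<zeta>. \<zeta> \<in> proximal_normal_cone (reachable_within F K (real_of_ereal (min_time F K x))) x \<longrightarrow>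
           (\<zeta>, min_hamiltonian F x \<zeta>)
             \<in> proximal_normal_cone (epi (min_time F K)) (x, real_of_ereal (min_time F K x))) \<and>
         (\<forall>\<zeta> \<alpha>. (\<zeta>, \<alpha>)
             \<in> proximal_normal_cone (epi (min_time F K)) (x, real_of_ereal (min_time F K x)) \<longrightarrow>
           \<alpha> \<le> 0 \<and>
           \<zeta> \<in> proximal_normal_cone (reachable_within F K (real_of_ereal (min_time F K x))) x \<and>
           min_hamiltonian F x \<zeta> = \<alpha>)"
proof -
  \<comment> \<open>Finiteness makes \<open>real_of_ereal\<close> faithful; positivity leaves room
    to move \<open>x\<close> forward for a positive time.\<close>
  have "min_time F K x < \<infinity>" "0 < min_time F K x"
    using assms min_time_pos by (auto simp: controllable_set_def)
  then obtain \<tau> where \<tau>: "min_time F K x = ereal \<tau>" "0 < \<tau>"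
    by (cases "min_time F K x") auto
  then have "real_of_ereal (min_time F K x) = \<tau>" by simp
  then show ?thesis
    using epi_normal_of_reachable_normal[OF assms(1) \<tau>] reachable_normal_of_epi_normal[OF assms(1) \<tau>]
    by simp
qed

end
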